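(* Let $a,p,r,k,\mu$ be integers with $a>1$, $p\geq 1$, $r\geq 1$, $k\geq 1$ and $\mu\geq 1$. Let $G=K(a^{(p)};\mu a(p+r-1),\mu)$, let a $k$-edge-coloring of $G$ be given, and let $\omega_j=\omega(G(j))$ for $1\leq j\leq k$. Then the $k$-edge-coloring of $G$ can be embedded into a Hamiltonian decomposition of $G^*=K(a^{(p+r)};\mu a(p+r-1),\mu)$ if and only if all of the following hold: (i) $k=\mu a^2(p+r-1)/2$; (ii) every component of $G(j)$ is a path (possibly of length $0$) for $1\leq j\leq k$; (iii) $G(j)$ has exactly $a-1$ pure edges from each part, and at most $p-1$ mixed edges, for $1\leq j\leq k$; and (iv) $\omega_j\leq r$ for $1\leq j\leq k$.
   Context: $K(a^{(p)};\lambda,\mu)$ denotes the loopless multigraph whose vertex set is partitioned into $p$ parts, each of size $a$, in which every two distinct vertices in the same part are joined by exactly $\lambda$ edges and every two vertices in different parts are joined by exactly $\mu$ edges. An edge is pure if its two endpoints lie in the same part, and mixed if they lie in different parts. For fixed $\lambda,\mu$, $K(a^{(p)};\lambda,\mu)$ is regarded as the subgraph of $K(a^{(p+r)};\lambda,\mu)$ induced by the vertices of $p$ of its $p+r$ parts. A $k$-edge-coloring of a graph $G$ is a map $E(G)\to\{1,\dots,k\}$ (no properness is required; it need not be surjective). $G(j)$ is the spanning subgraph of $G$ with vertex set $V(G)$ and edge set the edges colored $j$ (so vertices incident with no edge of color $j$ are components of $G(j)$, i.e. paths of length $0$). $\omega(H)$ denotes the number of connected components of a graph $H$. A Hamiltonian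 decomposition of a graph is a partition of its edge set into edge sets of Hamiltonian cycles. A $k$-edge-coloring of $G$ is embedded into a Hamiltonian decomposition of a supergraph $G^*$ if it extends to a $k$-edge-coloring of $G^*$ (edges of $G$ keep their colors) in which each of the $k$ color classes is a Hamiltonian cycle of $G^*$. *)

theory Defs
  imports Complex_Main "HOL-Library.FuncSet"
begin

text \<open>Undirected loopless multigraphs: edges are objects of their own, and distinct edges may
  have the same set of (two) end vertices.\<close>

record ('v, 'e) multigraph =
  verts :: "'v set"
  edges :: "'e set"
  ends :: "'e \<Rightarrow> 'v set"

definition loopless_multigraph :: "('v, 'e) multigraph \<Rightarrow> bool" where
  "loopless_multigraph G \<longleftrightarrow> (\<forall>e\<in>edges G. ends G e \<subseteq> verts G \<and> card (ends G e) = 2)"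

definition induced_subgraph :: "('v, 'e) multigraph \<Rightarrow> 'v set \<Rightarrow> ('v, 'e) multigraph" where
  "induced_subgraph G S = G\<lparr>verts := S, edges := {e \<in> edges G. ends G e \<subseteq> S}\<rparr>"

definition spanning_subgraph :: "('v, 'e) multigraph \<Rightarrow> 'e set \<Rightarrow> ('v, 'e) multigraph" where
  "spanning_subgraph G F = G\<lparr>edges := F\<rparr>"

definition adjacency :: "('v, 'e) multigraph \<Rightarrow> ('v \<times> 'v) set" where
  "adjacency G = {(u, v). \<exists>e\<in>edges G. ends G e = {u, v}}"

definition connected_rel :: "('v, 'e) multigraph \<Rightarrow> ('v \<times> 'v) set" where
  "connected_rel G = {(u, v). u \<in> verts G \<and> v \<in> verts G \<and> (u, v) \<in> (adjacency G)\<^sup>*}"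

definition components :: "('v, 'e) multigraph \<Rightarrow> ('v, 'e) multigraph set" where
  "components G = induced_subgraph G ` (verts G // connected_rel G)"

definition num_components :: "('v, 'e) multigraph \<Rightarrow> nat" where
  "num_components G = card (components G)"

text \<open>A graph is a path or a cycle if all of its vertices and edges can be listed along it. A
  single vertex is a path of length 0; as usual for multigraphs, two parallel edges form a cycle
  of length 2.\<close>

definition is_path :: "('v, 'e) multigraph \<Rightarrow> bool" where
  "is_path G \<longleftrightarrow> (\<exists>xs es.
     distinct xs \<and> set xs = verts G \<and> distinct es \<and> set es = edges G \<and>
     length xs = Suc (length es) \<and>
     (\<forall>i<length es. ends G (es ! i) = {xs ! i, xs ! Suc i}))"

definition is_cycle :: "('v, 'e) multigraph \<Rightarrow> bool" where
  "is_cycle G \<longleftrightarrow> (\<exists>xs es.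
     distinct xs \<and> set xs = verts G \<and> distinct es \<and> set es = edges G \<and>
     length xs = length es \<and> 2 \<le> length es \<and>
     (\<forall>i<length es. ends G (es ! i) = {xs ! i, xs ! (Suc i mod length es)}))"

definition hamiltonian_cycle :: "('v, 'e) multigraph \<Rightarrow> 'e set \<Rightarrow> bool" where
  "hamiltonian_cycle G F \<longleftrightarrow> F \<subseteq> edges G \<and> is_cycle (spanning_subgraph G F)"

definition edge_coloring :: "('v, 'e) multigraph \<Rightarrow> nat \<Rightarrow> ('e \<Rightarrow> nat) \<Rightarrow> bool" where
  "edge_coloring G k c \<longleftrightarrow> c \<in> edges G \<rightarrow> {1..k}"

definition color_class :: "('v, 'e) multigraph \<Rightarrow> ('e \<Rightarrow> nat) \<Rightarrow> nat \<Rightarrow> 'e set" where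
  "color_class G c j = {e \<in> edges G. c e = j}"

definition color_subgraph ::
  "('v, 'e) multigraph \<Rightarrow> ('e \<Rightarrow> nat) \<Rightarrow> nat \<Rightarrow> ('v, 'e) multigraph" where
  "color_subgraph G c j = spanning_subgraph G (color_class G c j)"

definition embeds_in_hamiltonian_decomposition ::
  "('v, 'e) multigraph \<Rightarrow> nat \<Rightarrow> ('e \<Rightarrow> nat) \<Rightarrow> ('v, 'e) multigraph \<Rightarrow> bool" where
  "embeds_in_hamiltonian_decomposition G k c H \<longleftrightarrow> (\<exists>c'.
     edge_coloring H k c' \<and> (\<forall>e\<in>edges G. c' e = c e) \<and>
     (\<forall>j\<in>{1..k}. hamiltonian_cycle H (color_class H c' j)))"

text \<open>The vertices of \<open>K a p l m\<close> (\<open>p\<close> parts of size \<open>a\<close>) are pairs of the index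
  \<open>i < p\<close> of a part and a position in that part. An edge is a pair of its set of end vertices and
  a number distinguishing it from its parallel edges, so that for \<open>p \<le> q\<close> the edges of
  \<open>K a p l m\<close> are literally edges of \<open>K a q l m\<close>.\<close>

definition part :: "nat \<Rightarrow> nat \<Rightarrow> (nat \<times> nat) set" where
  "part a i = {i} \<times> {..<a}"

definition K :: "nat \<Rightarrow> nat \<Rightarrow> nat \<Rightarrow> nat \<Rightarrow> (nat \<times> nat, (nat \<times> nat) set \<times> nat) multigraph" where
  "K a p l m =
     \<lparr>verts = (\<Union>i<p. part a i),
      edges = {({u, v}, n) | u v n. u \<in> (\<Union>i<p. part a i) \<and> v \<in> (\<Union>i<p. part a i) \<and> u \<noteq> v \<and>
                 n < (if fst u = fst v then l else m)},
      ends = fst\<rparr>"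

definition pure_edges :: "nat \<Rightarrow> (nat \<times> nat, 'e) multigraph \<Rightarrow> nat \<Rightarrow> 'e set" where
  "pure_edges a G i = {e \<in> edges G. ends G e \<subseteq> part a i}"

definition mixed_edges :: "(nat \<times> nat, 'e) multigraph \<Rightarrow> 'e set" where
  "mixed_edges G = {e \<in> edges G. \<exists>u v. ends G e = {u, v} \<and> fst u \<noteq> fst v}"

lemma loopless_multigraph_K: "loopless_multigraph (K a p l m)"
  unfolding loopless_multigraph_def K_def multigraph.simps by (auto simp del: UN_iff)

lemma mem_edges_K_iff:
  assumes "u \<noteq> v"
  shows "({u, v}, n) \<in> edges (K a p l m) \<longleftrightarrow>
    u \<in> verts (K a p l m) \<and> v \<in> verts (K a p l m) \<and> n < (if fst u = fst v then l else m)"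
    (is "?L \<longleftrightarrow> ?R")
proof
  assume ?L
  then obtain u' v' where *: "{u, v} = {u', v'}" "u' \<in> verts (K a p l m)"
    "v' \<in> verts (K a p l m)" "n < (if fst u' = fst v' then l else m)"
    unfolding K_def multigraph.simps by blast
  from *(1) consider "u = u'" "v = v'" | "u = v'" "v = u'"
    by (auto simp: doubleton_eq_iff)
  then show ?R
  proof cases
    case 1
    then show ?thesis using * by simp
  next
    case 2
    then show ?thesis using * by (simp add: eq_commute[of "fst u'"])
  qed
next
  assume ?R
  then show ?L
    using assms unfolding K_def multigraph.simps by blast
qed

lemma multiplicity_K:
  assumes "u \<in> verts (K a p l m)" "v \<in> verts (K a p l m)" "u \<noteq> v"
  shows "card {e \<in> edges (K a p l m). ends (K a p l m) e = {u, v}} =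
           (if fst u = fst v then l else m)"
proof -
  let ?N = "if fst u = fst v then l else m"
  have "{e \<in> edges (K a p l m). ends (K a p l m) e = {u, v}} =
          {e \<in> edges (K a p l m). fst e = {u, v}}"
    by (simp add: K_def)
  also have "\<dots> = Pair {u, v} ` {n. ({u, v}, n) \<in> edges (K a p l m)}"
    by force
  also have "{n. ({u, v}, n) \<in> edges (K a p l m)} = {..<?N}"
    by (simp add: mem_edges_K_iff[OF assms(3)] assms lessThan_def)
  finally show ?thesis
    by (simp add: card_image inj_on_def)
qed

lemma induced_subgraph_K:
  assumes "p \<le> q"
  shows "induced_subgraph (K a q l m) (\<Union>i<p. part a i) = K a p l m"
proof -
  define V where "V q = (\<Union>i<q. part a i)" for q
  have K: "K a q l m =
     \<lparr>verts = V q,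
      edges = {({u, v}, n) | u v n. u \<in> V q \<and> v \<in> V q \<and> u \<noteq> v \<and>
                 n < (if fst u = fst v then l else m)},
      ends = fst\<rparr>" for q
    by (simp only: K_def V_def)
  have "V p \<subseteq> V q"
    unfolding V_def using assms by (intro UN_mono) auto
  have "{e \<in> edges (K a q l m). fst e \<subseteq> V p} = edges (K a p l m)"
  proof (intro equalityI subsetI)
    fix e assume "e \<in> {e \<in> edges (K a q l m). fst e \<subseteq> V p}"
    then obtain u v n where "e = ({u, v}, n)" "u \<noteq> v" "u \<in> V p" "v \<in> V p"
      "n < (if fst u = fst v then l else m)"
      unfolding K multigraph.simps by fastforce
    then show "e \<in> edges (K a p l m)"
      unfolding K multigraph.simps by blast
  next
    fix e assume "e \<in> edges (K a p l m)"
    then obtain u v n where "e = ({u, v}, n)" "u \<noteq> v" "u \<in> V p" "v \<in> V p"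
      "n < (if fst u = fst v then l else m)"
      unfolding K multigraph.simps by blast
    moreover from this have "u \<in> V q" "v \<in> V q"
      using \<open>V p \<subseteq> V q\<close> by auto
    ultimately have "e \<in> edges (K a q l m)" "fst e \<subseteq> V p"
      unfolding K multigraph.simps by (blast, simp)
    then show "e \<in> {e \<in> edges (K a q l m). fst e \<subseteq> V p}"
      by simp
  qed
  then show ?thesis
    unfolding V_def[symmetric] by (simp add: induced_subgraph_def K)
qed

lemma equiv_connected_rel: "equiv (verts G) (connected_rel G)"
proof (rule equivI)
  have "sym (adjacency G)"
    by (auto simp: sym_def adjacency_def insert_commute)
  then show "sym (connected_rel G)"
    using sym_rtrancl[of "adjacency G"] by (auto simp: connected_rel_def sym_def)
qed (auto simp: connected_rel_def refl_on_def trans_def)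

end

theory Submission
  imports Defs "HOL-Library.Multiset"
begin

text \<open>
  Write \<open>l = \<mu> * a * (p + r - 1)\<close> for the pure multiplicity. It equals the
  number of mixed edges at a vertex of the large graph, and this forces every Hamiltonian cycle of a
  decomposition to run through each part along a path.

  Necessity is a matter of counting. Degrees give \<open>2 * k = l * a\<close>. A Hamiltonian cycle restricted to
  a part is a union of paths and has at most \<open>a - 1\<close> edges there, while all \<open>k\<close> cycles together use
  \<open>k * (a - 1)\<close> edges, so each uses exactly \<open>a - 1\<close>. Restricted to \<open>G\<close>, a cycle is again a union of
  paths, and it has as many components inside \<open>G\<close> as outside of it. The \<open>r\<close> new parts have at most one
  component each, because the cycle runs through each of them along a path
  (\<open>edge_count_complement\<close>, \<open>embedding_necessary\<close>).

  Sufficiency uses amalgamations and detachments. Identify all new vertices with one vertex \<open>w\<close>. The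
  path components of \<open>G(j)\<close>, joined to \<open>w\<close> at both ends, and loops at \<open>w\<close> form a bundle of \<open>r\<close> closed
  walks through \<open>w\<close>, the ears of color \<open>j\<close>; the bound on the number of components makes room
  for the path components among them. A new vertex \<open>z\<close> is split off \<open>w\<close> by choosing two half-edges
  from different ears in every color and moving them to \<open>z\<close>, which merges these two ears into one. The
  color classes stay connected by construction, and when only one ear is left, the color class is
  a cycle. The multiplicities come out right if, with \<open>g\<close> ears per color, exactly a \<open>g\<close>-th of the edges from \<open>w\<close> to
  any vertex is moved. Such a choice exists by Hall's theorem (\<open>balanced_selection\<close>), and
  iterating it gives \<open>detachment\<close>.

  The detachment is done in two stages. The vertex \<open>w\<close> is first split into \<open>r\<close> vertices, one per new
  part (\<open>amalgamated_decomposition\<close>). Then each of these receives \<open>a - 1\<close> loops in every color, standing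
  for the pure edges of its part, and is split into \<open>a\<close> vertices (\<open>split_next_part\<close>). As both stages
  only fix how many edges of each color join two vertices, the colors are distributed among the
  individual parallel edges at the end (\<open>extend_coloring\<close>).
\<close>

section \<open>Walks and the multisets of their steps\<close>

text \<open>The edges traversed by a walk, kept only as a multiset of end sets: parallel edges are
  interchangeable until the final step, where colors are handed out to individual edges.\<close>

fun steps :: "'v list \<Rightarrow> 'v set multiset" where
  "steps (x # y # xs) = add_mset {x, y} (steps (y # xs))"
| "steps _ = {#}"

definition closed_steps :: "'v list \<Rightarrow> 'v set multiset" where
  "closed_steps xs = steps (xs @ take 1 xs)"

lemma closed_steps_Cons: "closed_steps (x # xs) = steps (x # xs @ [x])"
  by (simp add: closed_steps_def)

lemma steps_append: "steps (xs @ x # ys) = steps (xs @ [x]) + steps (x # ys)"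
proof (induction xs)
  case (Cons a xs)
  then show ?case by (cases xs) auto
qed simp

lemma steps_Cons: "xs \<noteq> [] \<Longrightarrow> steps (x # xs) = add_mset {x, hd xs} (steps xs)"
  by (cases xs) auto

lemma steps_snoc: "xs \<noteq> [] \<Longrightarrow> steps (xs @ [y]) = add_mset {last xs, y} (steps xs)"
  by (cases xs rule: rev_cases) (simp_all add: steps_append[of _ _ "[y]"])

lemma steps_rev: "steps (rev xs) = steps xs"
proof (induction xs)
  case (Cons a xs)
  then show ?case by (cases xs) (auto simp: steps_append[of _ _ "[a]"] insert_commute)
qed simp

lemma steps_around:
  assumes "L \<noteq> []"
  shows "steps (w # L @ [w]) = add_mset {w, hd L} (add_mset {w, last L} (steps L))"
  using assms by (simp add: steps_Cons steps_snoc insert_commute)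

text \<open>Cutting a cycle open at a prescribed vertex, be it one outside a given set or one that is going to
  be detached.\<close>

lemma closed_steps_rotate:
  assumes "w \<in> set xs"
  obtains L where "mset xs = mset (w # L)" "closed_steps xs = steps (w # L @ [w])"
proof -
  obtain A B where xs: "xs = A @ w # B" using assms by (meson split_list)
  show thesis
  proof (cases A)
    case Nil
    then show ?thesis using that[of B] xs by (simp add: closed_steps_Cons)
  next
    case (Cons a A')
    have "closed_steps xs = steps (a # (A' @ [w])) + steps (w # B @ [a])"
      using steps_append[of "a # A'" w "B @ [a]"] by (simp add: xs Cons closed_steps_Cons)
    moreover have "steps (w # (B @ a # A') @ [w]) = steps (w # B @ [a]) + steps (a # A' @ [w])"
      using steps_append[of "w # B" a "A' @ [w]"] by simp
    ultimately have "closed_steps xs = steps (w # (B @ a # A') @ [w])"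
      by (simp add: add.commute)
    then show ?thesis using that[of "B @ a # A'"] by (simp add: xs Cons)
  qed
qed

lemma steps_conv_nth:
  "steps xs = mset (map (\<lambda>i. {xs ! i, xs ! Suc i}) [0..<length xs - 1])"
proof (induction xs)
  case (Cons x xs)
  show ?case
  proof (cases xs)
    case (Cons y ys)
    have "[0..<length (x # xs) - 1] = 0 # map Suc [0..<length xs - 1]"
      using Cons by (simp add: map_Suc_upt upt_conv_Cons del: upt_Suc)
    then show ?thesis using Cons.IH Cons by (simp add: comp_def)
  qed simp
qed simp

lemma closed_steps_conv_nth:
  "closed_steps xs = mset (map (\<lambda>i. {xs ! i, xs ! (Suc i mod length xs)}) [0..<length xs])"
proof (cases xs)
  case (Cons x ys)
  have "closed_steps xs
      = mset (map (\<lambda>i. {(xs @ [x]) ! i, (xs @ [x]) ! Suc i}) [0..<length xs])"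
    using Cons by (simp add: closed_steps_def steps_conv_nth)
  also have "map (\<lambda>i. {(xs @ [x]) ! i, (xs @ [x]) ! Suc i}) [0..<length xs]
      = map (\<lambda>i. {xs ! i, xs ! (Suc i mod length xs)}) [0..<length xs]"
  proof (rule map_cong[OF refl])
    fix i assume "i \<in> set [0..<length xs]"
    then have "i < length xs" by simp
    moreover have "(xs @ [x]) ! Suc i = xs ! (Suc i mod length xs)"
      using \<open>i < length xs\<close> Cons by (cases "Suc i = length xs") (auto simp: nth_append)
    ultimately show "{(xs @ [x]) ! i, (xs @ [x]) ! Suc i} = {xs ! i, xs ! (Suc i mod length xs)}"
      by (simp add: nth_append)
  qed
  finally show ?thesis .
qed (simp add: closed_steps_def)

lemma size_steps: "size (steps xs) = length xs - 1"
  by (simp add: steps_conv_nth)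

lemma steps_subset: "e \<in># steps xs \<Longrightarrow> e \<subseteq> set xs"
  by (induction xs rule: steps.induct) auto

lemma closed_steps_subset: "e \<in># closed_steps xs \<Longrightarrow> e \<subseteq> set xs"
  using steps_subset[of e "xs @ take 1 xs"] set_take_subset[of 1 xs]
  by (auto simp: closed_steps_def)

lemma closed_steps_distinct_card:
  assumes "distinct xs" "2 \<le> length xs" "e \<in># closed_steps xs"
  shows "card e = 2"
proof -
  obtain i where i: "i < length xs" "e = {xs ! i, xs ! (Suc i mod length xs)}"
    using assms(3) by (auto simp: closed_steps_conv_nth)
  have "Suc i mod length xs < length xs" "Suc i mod length xs \<noteq> i"
    using i(1) assms(2) by (cases "Suc i = length xs"; auto)+
  then show ?thesis using i assms(1) by (simp add: nth_eq_iff_index_eq)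
qed

section \<open>Degrees in multisets of edges\<close>

text \<open>A loop counts once here, so this is the degree only at vertices without loops. The lemmas
  below are about such vertices.\<close>

abbreviation degree_in :: "'v set multiset \<Rightarrow> 'v \<Rightarrow> nat" where
  "degree_in M v \<equiv> size (filter_mset (\<lambda>e. v \<in> e) M)"

lemma degree_in_around:
  assumes "distinct L" "v \<noteq> w"
  shows "degree_in (steps (w # L @ [w])) v = 2 * count (mset L) v"
  using assms
proof (induction L rule: steps.induct)
  case (1 x y xs)
  have "steps (w # (x # y # xs) @ [w]) + {#{w, y}#}
      = steps (w # (y # xs) @ [w]) + {#{w, x}, {x, y}#}"
    by simp
  then have "degree_in (steps (w # (x # y # xs) @ [w]) + {#{w, y}#}) v
      = degree_in (steps (w # (y # xs) @ [w]) + {#{w, x}, {x, y}#}) v"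
    by (simp only:)
  then show ?case using 1 by (auto split: if_splits)
qed auto

lemma degree_in_centre:
  assumes "w \<notin> set L" "L \<noteq> []"
  shows "degree_in (steps (w # L @ [w])) w = 2"
proof -
  have "filter_mset (\<lambda>e. w \<in> e) (steps L) = {#}"
    using assms(1) steps_subset[of _ L] by (auto simp: multiset_eq_iff count_eq_zero_iff)
  then show ?thesis unfolding steps_around[OF assms(2)] by simp
qed

lemma degree_in_closed_steps:
  assumes "distinct xs" "2 \<le> length xs" "v \<in> set xs"
  shows "degree_in (closed_steps xs) v = 2"
proof -
  obtain L where L: "mset xs = mset (v # L)" "closed_steps xs = steps (v # L @ [v])"
    using closed_steps_rotate[OF assms(3)] .
  have "distinct (v # L)" using L(1) assms(1) mset_eq_imp_distinct_iff by blast
  moreover have "L \<noteq> []" using L(1) assms(2) by (metis size_mset length_Cons list.size(3)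
    le_numeral_extra(4) not_less_eq_eq numeral_2_eq_2 One_nat_def)
  ultimately show ?thesis using degree_in_centre[of v L] L(2) by simp
qed

lemma degree_in_eq_sum_count:
  assumes "finite A" "v \<notin> A" "\<And>e. e \<in># M \<Longrightarrow> v \<in> e \<Longrightarrow> \<exists>u\<in>A. e = {v, u}"
  shows "degree_in M v = (\<Sum>u\<in>A. count M {v, u})"
proof -
  have inj: "inj_on (\<lambda>u. {v, u}) A" by (auto simp: inj_on_def doubleton_eq_iff)
  have "degree_in M v = (\<Sum>e \<in> (\<lambda>u. {v, u}) ` A. count (filter_mset (\<lambda>e. v \<in> e) M) e)"
    unfolding size_multiset_overloaded_eq using assms
    by (intro sum.mono_neutral_left) (auto simp: count_eq_zero_iff)
  also have "\<dots> = (\<Sum>u\<in>A. count M {v, u})"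
    by (subst sum.reindex[OF inj]) simp
  finally show ?thesis .
qed

section \<open>Systems of distinct representatives\<close>

text \<open>Hall's theorem, by the argument of Halmos and Vaughan: if some proper nonempty subset of
  \<open>A\<close> is tight, it is matched by induction and Hall's condition survives for the rest after its
  neighbors are removed; if none is tight, any single choice leaves enough slack.\<close>

lemma hall:
  fixes N :: "'a \<Rightarrow> 'b set"
  assumes "finite A" "\<And>x. x \<in> A \<Longrightarrow> finite (N x)"
    and "\<And>B. B \<subseteq> A \<Longrightarrow> card B \<le> card (\<Union>x\<in>B. N x)"
  shows "\<exists>f. inj_on f A \<and> (\<forall>x\<in>A. f x \<in> N x)"
  using assms
proof (induction "card A" arbitrary: A N rule: less_induct)
  case less
  note finA = less.prems(1) and finN = less.prems(2) and hall = less.prems(3)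
  consider "A = {}"
    | (crit) B where "B \<subset> A" "B \<noteq> {}" "card (\<Union>x\<in>B. N x) = card B"
    | (slack) "A \<noteq> {}" "\<And>B. B \<subset> A \<Longrightarrow> B \<noteq> {} \<Longrightarrow> card B < card (\<Union>x\<in>B. N x)"
    using hall by (metis le_neq_implies_less psubset_imp_subset)
  then show ?case
  proof cases
    case crit
    define U where "U = (\<Union>x\<in>B. N x)"
    have finB: "finite B" and finU: "finite U"
      using crit(1) finA finN by (auto simp: U_def intro: finite_subset intro!: finite_UN_I)
    have "\<exists>f. inj_on f B \<and> (\<forall>x\<in>B. f x \<in> N x)"
      using crit(1) finN hall by (intro less.hyps finB psubset_card_mono[OF finA]) auto
    then obtain f where f: "inj_on f B" "\<forall>x\<in>B. f x \<in> N x" by blast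
    have "\<exists>h. inj_on h (A - B) \<and> (\<forall>x\<in>A - B. h x \<in> N x - U)"
    proof (rule less.hyps)
      show "card (A - B) < card A"
        using crit finA finB by (intro psubset_card_mono) auto
      fix C assume C: "C \<subseteq> A - B"
      have finC: "finite C" using C finA by (auto intro: finite_subset)
      have "card B + card C = card (B \<union> C)"
        using C finB finC by (subst card_Un_disjoint) auto
      also have "\<dots> \<le> card (\<Union>x\<in>B \<union> C. N x)"
        using crit(1) C by (intro hall) auto
      also have "(\<Union>x\<in>B \<union> C. N x) = U \<union> (\<Union>x\<in>C. N x - U)"
        by (auto simp: U_def)
      also have "card \<dots> \<le> card U + card (\<Union>x\<in>C. N x - U)"
        by (rule card_Un_le)
      finally show "card C \<le> card (\<Union>x\<in>C. N x - U)"
        using crit(3) by (simp add: U_def)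
    qed (use finA finN in auto)
    then obtain h where h: "inj_on h (A - B)" "\<forall>x\<in>A - B. h x \<in> N x - U" by blast
    have "inj_on (\<lambda>x. if x \<in> B then f x else h x) A"
    proof (rule inj_onI)
      have "f x \<noteq> h x'" if "x \<in> B" "x' \<in> A" "x' \<notin> B" for x x'
        using f(2) h(2) that by (force simp: U_def)
      then show "x = x'" if "x \<in> A" "x' \<in> A"
        "(if x \<in> B then f x else h x) = (if x' \<in> B then f x' else h x')" for x x'
        using that f(1) h(1) by (auto simp: inj_on_def split: if_splits dest: sym)
    qed
    moreover have "\<forall>x\<in>A. (if x \<in> B then f x else h x) \<in> N x" using f h by auto
    ultimately show ?thesis by (intro exI conjI)
  next
    case slack
    then obtain x where x: "x \<in> A" by blast
    have "card {x} \<le> card (N x)" using hall[of "{x}"] x by simp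
    then have "N x \<noteq> {}" by auto
    then obtain y where y: "y \<in> N x" by blast
    have "\<exists>h. inj_on h (A - {x}) \<and> (\<forall>z\<in>A - {x}. h z \<in> N z - {y})"
    proof (rule less.hyps)
      show "card (A - {x}) < card A" using x finA by (intro psubset_card_mono) auto
      fix C assume C: "C \<subseteq> A - {x}"
      show "card C \<le> card (\<Union>z\<in>C. N z - {y})"
      proof (cases "C = {}")
        case False
        have fin: "finite (\<Union>z\<in>C. N z)" using C finA finN by (auto intro: finite_subset)
        have "card C < card (\<Union>z\<in>C. N z)" using C x False by (intro slack) auto
        also have "\<dots> \<le> card (insert y (\<Union>z\<in>C. N z - {y}))"
          using fin by (intro card_mono) auto
        also have "\<dots> \<le> Suc (card (\<Union>z\<in>C. N z - {y}))" by (rule card_insert_le_m1) auto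
        finally show ?thesis by simp
      qed simp
    qed (use finA finN in auto)
    then obtain h where h: "inj_on h (A - {x})" "\<forall>z\<in>A - {x}. h z \<in> N z - {y}" by blast
    have "inj_on (h(x := y)) A" using h by (auto simp: inj_on_def)
    moreover have "\<forall>z\<in>A. (h(x := y)) z \<in> N z" using h y by auto
    ultimately show ?thesis by (intro exI conjI)
  qed simp
qed

lemma sum_if_card: "finite S \<Longrightarrow> (\<Sum>x\<in>S. if P x then 1 else 0) = card {x \<in> S. P x}"
  by (simp add: sum.If_cases Int_def)

text \<open>The combinatorial heart of a detachment step. Every color \<open>j\<close> owns \<open>g\<close> ears, ear \<open>i\<close> having the
  two ends \<open>\<alpha> j i\<close> and \<open>\<beta> j i\<close>, and every vertex \<open>v\<close> is the end of \<open>g * m v\<close> of them. Picking a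
  fraction \<open>1/g\<close> of every end is fractionally possible; the point is to do it integrally, taking
  exactly two ends per color and never both ends of one ear.

  Make \<open>m v\<close> slots for every vertex \<open>v\<close>, each of which may be filled by an ear ending at \<open>v\<close>, and
  \<open>g - 2\<close> further slots for every color \<open>j\<close>, each of which may be filled by any ear of \<open>j\<close>. With
  the incidences at \<open>v\<close> shared out among its slots, both the slots and the ears have degree \<open>g\<close>: an
  ear is wanted by its two ends and by the \<open>g - 2\<close> slots of its color. Hence Hall's condition holds
  and there is a perfect matching. It leaves two ears of each color for the slots of vertices,
  and these two are distinct because an ear fills only one slot.\<close>

lemma balanced_selection:
  fixes \<alpha> \<beta> :: "'j \<Rightarrow> nat \<Rightarrow> 'v" and m :: "'v \<Rightarrow> nat"
  assumes "finite J" "2 \<le> g"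
    and bal: "\<And>v. (\<Sum>j\<in>J. \<Sum>i<g. count {#\<alpha> j i, \<beta> j i#} v) = g * m v"
  shows "\<exists>i\<^sub>1 i\<^sub>2 x\<^sub>1 x\<^sub>2. (\<forall>j\<in>J. i\<^sub>1 j < g \<and> i\<^sub>2 j < g \<and> i\<^sub>1 j \<noteq> i\<^sub>2 j \<and>
      x\<^sub>1 j \<in> {\<alpha> j (i\<^sub>1 j), \<beta> j (i\<^sub>1 j)} \<and> x\<^sub>2 j \<in> {\<alpha> j (i\<^sub>2 j), \<beta> j (i\<^sub>2 j)}) \<and>
    (\<forall>v. (\<Sum>j\<in>J. count {#x\<^sub>1 j, x\<^sub>2 j#} v) = m v)"
proof -
  define ears where "ears = J \<times> {..<g}"
  define X where "X = (\<Union>(j, i)\<in>ears. {\<alpha> j i, \<beta> j i})"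
  define slots :: "('v \<times> nat + 'j \<times> nat) set" where
    "slots = Sigma X (\<lambda>v. {..<m v}) <+> J \<times> {..<g - 2}"
  define N :: "'v \<times> nat + 'j \<times> nat \<Rightarrow> ('j \<times> nat) set" where
    "N s = (case s of Inl (v, _) \<Rightarrow> {(j, i) \<in> ears. v = \<alpha> j i \<or> v = \<beta> j i}
      | Inr (j, _) \<Rightarrow> {j} \<times> {..<g})" for s
  define h :: "'j \<times> nat \<Rightarrow> 'v \<Rightarrow> nat" where
    "h e v = (if \<alpha> (fst e) (snd e) = v then 1 else 0) + (if \<beta> (fst e) (snd e) = v then 1 else 0)"
    for e v
  have fin: "finite ears" "finite X" "finite slots"
    using assms(1) by (auto simp: ears_def X_def slots_def)
  have h0: "h e v = 0" if "e \<notin> N (Inl (v, t))" "e \<in> ears" for e v t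
    using that by (auto simp: h_def N_def split: prod.splits)
  have bal': "(\<Sum>e\<in>ears. h e v) = g * m v" for v
  proof -
    have "(\<Sum>e\<in>ears. h e v) = (\<Sum>j\<in>J. \<Sum>i<g. h (j, i) v)"
      by (simp add: ears_def sum.cartesian_product)
    also have "\<dots> = (\<Sum>j\<in>J. \<Sum>i<g. count {#\<alpha> j i, \<beta> j i#} v)"
      by (intro sum.cong) (auto simp: h_def)
    finally show ?thesis by (simp only: bal)
  qed
  have X: "v \<in> X" if "t < m v" for v t
  proof (rule ccontr)
    assume "v \<notin> X"
    then have "(\<Sum>e\<in>ears. h e v) = 0" by (intro sum.neutral) (auto simp: h_def X_def)
    then show False using bal'[of v] that assms(2) by simp
  qed
  have sum_h: "(\<Sum>v\<in>Y. h e v) \<le> 2" if "finite Y" for e Y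
    using that by (simp add: h_def sum.distrib)
  have sum_hX: "(\<Sum>v\<in>X. h e v) = 2" if "e \<in> ears" for e
    using that fin(2) by (force simp: h_def sum.distrib X_def)
  \<comment> \<open>Hall yields an injection of the slots; equal cardinalities make it a bijection onto the ears.\<close>
  have card_slots: "card slots = card ears"
  proof -
    have "g * (\<Sum>v\<in>X. m v) = (\<Sum>v\<in>X. \<Sum>e\<in>ears. h e v)"
      by (simp add: bal' sum_distrib_left)
    also have "\<dots> = (\<Sum>e\<in>ears. 2)"
      by (subst sum.swap) (simp add: sum_hX)
    also have "\<dots> = g * (2 * card J)" by (simp add: ears_def card_cartesian_product)
    finally have "(\<Sum>v\<in>X. m v) = 2 * card J" using assms(2) by simp
    then have "card slots = 2 * card J + card J * (g - 2)"
      unfolding slots_def using fin assms(1) by (subst card_Plus) (auto simp: card_cartesian_product)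
    also have "\<dots> = card J * (2 + (g - 2))" by (simp only: add_mult_distrib2 mult.commute)
    also have "2 + (g - 2) = g" using assms(2) by simp
    finally show ?thesis by (simp add: ears_def card_cartesian_product)
  qed
  have "\<exists>f. inj_on f slots \<and> (\<forall>s\<in>slots. f s \<in> N s)"
  proof (rule hall[OF fin(3)])
    show "finite (N s)" for s
      using fin(1) by (auto simp: N_def split: sum.splits prod.splits intro: finite_subset)
    fix B assume B: "B \<subseteq> slots"
    define Y where "Y = {v. \<exists>t. Inl (v, t) \<in> B}"
    define D where "D = {j. \<exists>t. Inr (j, t) \<in> B}"
    have YD: "Y \<subseteq> X" "D \<subseteq> J" using B by (auto simp: Y_def D_def slots_def)
    then have finYD: "finite Y" "finite D" using fin assms(1) by (auto intro: finite_subset)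
    define U where "U = (\<Union>s\<in>B. N s)"
    have U: "U \<subseteq> ears"
      using B by (auto simp: U_def N_def slots_def ears_def split: sum.splits prod.splits)
    have h0': "h e v = 0" if "e \<in> ears - U" "v \<in> Y" for e v
    proof -
      obtain t where "Inl (v, t) \<in> B" using \<open>v \<in> Y\<close> by (auto simp: Y_def)
      then show ?thesis using that(1) by (intro h0[of e v t]) (auto simp: U_def)
    qed
    have "B \<subseteq> Sigma Y (\<lambda>v. {..<m v}) <+> D \<times> {..<g - 2}"
    proof
      fix s assume "s \<in> B"
      then show "s \<in> Sigma Y (\<lambda>v. {..<m v}) <+> D \<times> {..<g - 2}"
        using B by (cases s) (auto simp: Y_def D_def slots_def)
    qed
    then have "card B \<le> card (Sigma Y (\<lambda>v. {..<m v}) <+> D \<times> {..<g - 2})"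
      using finYD by (intro card_mono) auto
    also have "\<dots> = (\<Sum>v\<in>Y. m v) + card D * (g - 2)"
      using finYD by (subst card_Plus) (auto simp: card_cartesian_product)
    finally have "g * card B \<le> g * ((\<Sum>v\<in>Y. m v) + card D * (g - 2))"
      by (rule mult_le_mono2)
    also have "\<dots> = (\<Sum>v\<in>Y. g * m v) + card (D \<times> {..<g}) * (g - 2)"
      by (simp add: sum_distrib_left algebra_simps card_cartesian_product)
    \<comment> \<open>Double counting: a neighboring ear contributes at most 2 through its ends and, if its
        color occurs in \<open>D\<close>, \<open>g - 2\<close> through the slots of that color.\<close>
    also have "(\<Sum>v\<in>Y. g * m v) = (\<Sum>v\<in>Y. \<Sum>e\<in>U. h e v)"
      unfolding bal'[symmetric] using fin(1) U h0'
      by (intro sum.cong refl sum.mono_neutral_right) auto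
    also have "\<dots> \<le> (\<Sum>e\<in>U. 2)"
      by (subst sum.swap) (intro sum_mono sum_h finYD)
    also have "\<dots> + card (D \<times> {..<g}) * (g - 2) \<le> card U * 2 + card U * (g - 2)"
    proof -
      have "D \<times> {..<g} \<subseteq> U"
        unfolding U_def D_def N_def by (force split: sum.splits)
      then have "card (D \<times> {..<g}) \<le> card U"
        using finite_subset[OF U fin(1)] by (intro card_mono)
      then show ?thesis by simp
    qed
    also have "\<dots> = card U * (2 + (g - 2))" by (rule add_mult_distrib2[symmetric])
    also have "2 + (g - 2) = g" using assms(2) by simp
    also have "card U * g = g * card U" by (rule mult.commute)
    finally show "card B \<le> card (\<Union>s\<in>B. N s)" using assms(2) by (simp add: U_def)
  qed
  then obtain f where f: "inj_on f slots" "\<And>s. s \<in> slots \<Longrightarrow> f s \<in> N s" by blast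
  have "f ` slots = ears"
  proof (rule card_subset_eq[OF fin(1)])
    show "f ` slots \<subseteq> ears"
      using f(2) by (fastforce simp: N_def slots_def ears_def split: sum.splits)
  qed (simp add: card_image f(1) card_slots)
  define used where "used j = {i. (j, i) \<in> f ` Inl ` Sigma X (\<lambda>v. {..<m v})}" for j
  define d where "d e = fst (projl (inv_into slots f e))" for e
  have d: "d (f (Inl (v, t))) = v" if "v \<in> X" "t < m v" for v t
    using that inv_into_f_f[OF f(1), of "Inl (v, t)"] by (simp add: d_def slots_def InlI)
  have used: "used j \<subseteq> {..<g} \<and> card (used j) = 2 \<and> (\<forall>i\<in>used j. d (j, i) \<in> {\<alpha> j i, \<beta> j i})"
    if j: "j \<in> J" for j
  proof -
    \<comment> \<open>The ears of color \<open>j\<close> that fill the \<open>g - 2\<close> slots of that color; exactly two ears remain.\<close>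
    define dum where "dum t = snd (f (Inr (j, t)))" for t
    have dum: "f (Inr (j, t)) = (j, dum t)" if "t < g - 2" for t
      using f(2)[of "Inr (j, t)"] that j
      by (cases "f (Inr (j, t))") (auto simp: slots_def N_def dum_def)
    have dis: "dum ` {..<g - 2} \<inter> used j = {}"
    proof (rule equals0I)
      fix i assume "i \<in> dum ` {..<g - 2} \<inter> used j"
      then obtain t v t' where "t < g - 2" "v \<in> X" "t' < m v"
        "f (Inr (j, t)) = f (Inl (v, t'))"
        by (auto simp: used_def dum)
      then show False using inj_onD[OF f(1), of "Inr (j, t)" "Inl (v, t')"] j
        by (auto simp: slots_def)
    qed
    have un: "dum ` {..<g - 2} \<union> used j = {..<g}"
    proof (intro equalityI subsetI)
      fix i assume "i \<in> {..<g}"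
      then have "(j, i) \<in> f ` slots" using j \<open>f ` slots = ears\<close> by (simp add: ears_def)
      then obtain s where s: "s \<in> slots" "f s = (j, i)" by auto
      show "i \<in> dum ` {..<g - 2} \<union> used j"
      proof (cases s)
        case (Inl vt)
        then have "vt \<in> Sigma X (\<lambda>v. {..<m v})" using s(1) by (auto simp: slots_def)
        then have "(j, i) \<in> f ` Inl ` Sigma X (\<lambda>v. {..<m v})"
          using s(2) Inl by (metis image_eqI)
        then show ?thesis by (simp add: used_def)
      next
        case (Inr jt)
        obtain j' t where jt: "jt = (j', t)" by (cases jt)
        have "j' = j" "t < g - 2" using f(2)[OF s(1)] s Inr jt by (auto simp: N_def slots_def)
        then show ?thesis using s(2) Inr jt by (force simp: dum_def)
      qed
    next
      fix i assume "i \<in> dum ` {..<g - 2} \<union> used j"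
      then have "(j, i) \<in> f ` slots"
      proof
        assume "i \<in> dum ` {..<g - 2}"
        then obtain t where "t < g - 2" "(j, i) = f (Inr (j, t))" using dum by auto
        then show ?thesis using j by (auto simp: slots_def)
      qed (auto simp: used_def slots_def)
      then show "i \<in> {..<g}" using \<open>f ` slots = ears\<close> by (simp add: ears_def)
    qed
    have "inj_on dum {..<g - 2}"
    proof (rule inj_onI)
      fix t t' assume "t \<in> {..<g - 2}" "t' \<in> {..<g - 2}" "dum t = dum t'"
      then show "t = t'" using inj_onD[OF f(1), of "Inr (j, t)" "Inr (j, t')"] j
        by (auto simp: slots_def dum)
    qed
    moreover have "finite (used j)" using un by (metis finite_Un finite_lessThan)
    ultimately have "card (used j) + (g - 2) = g"
      using card_Un_disjoint[OF _ _ dis] un by (simp add: card_image)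
    then have "card (used j) = 2" using assms(2) by linarith
    moreover have "d (j, i) \<in> {\<alpha> j i, \<beta> j i}" if i: "i \<in> used j" for i
    proof -
      obtain v t where vt: "v \<in> X" "t < m v" "(j, i) = f (Inl (v, t))"
        using i by (auto simp: used_def)
      then have "(j, i) \<in> N (Inl (v, t))" using f(2)[of "Inl (v, t)"] by (auto simp: slots_def)
      then show ?thesis using vt d by (auto simp: N_def)
    qed
    ultimately show ?thesis using un by blast
  qed
  then have fin_used: "finite (used j)" if "j \<in> J" for j
    using that finite_subset[of "used j" "{..<g}"] by blast
  have "\<exists>i\<^sub>1 i\<^sub>2. used j = {i\<^sub>1, i\<^sub>2} \<and> i\<^sub>1 \<noteq> i\<^sub>2" if "j \<in> J" for j
    using used[OF that] by (simp add: card_2_iff)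
  then obtain i\<^sub>1 i\<^sub>2 where i12: "\<And>j. j \<in> J \<Longrightarrow> used j = {i\<^sub>1 j, i\<^sub>2 j} \<and> i\<^sub>1 j \<noteq> i\<^sub>2 j"
    by metis
  have cnt: "(\<Sum>j\<in>J. count {#d (j, i\<^sub>1 j), d (j, i\<^sub>2 j)#} v) = m v" for v
  proof -
    have "(\<Sum>j\<in>J. count {#d (j, i\<^sub>1 j), d (j, i\<^sub>2 j)#} v)
        = (\<Sum>j\<in>J. \<Sum>i\<in>used j. if d (j, i) = v then 1 else 0)"
      using i12 by (intro sum.cong) auto
    also have "\<dots> = (\<Sum>e\<in>Sigma J used. if d e = v then 1 else 0)"
      using assms(1) fin_used by (simp add: sum.Sigma case_prod_beta)
    also have "\<dots> = card {e \<in> Sigma J used. d e = v}"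
      using assms(1) fin_used by (intro sum_if_card) auto
    also have "{e \<in> Sigma J used. d e = v} = (\<lambda>t. f (Inl (v, t))) ` {..<m v}"
    proof (intro equalityI subsetI)
      fix e assume "e \<in> {e \<in> Sigma J used. d e = v}"
      then show "e \<in> (\<lambda>t. f (Inl (v, t))) ` {..<m v}"
        by (auto simp: used_def d)
    next
      fix e assume "e \<in> (\<lambda>t. f (Inl (v, t))) ` {..<m v}"
      then obtain t where t: "t < m v" "e = f (Inl (v, t))" by auto
      then have "v \<in> X" using X by simp
      then have "e \<in> f ` slots" using t by (auto simp: slots_def)
      then have "fst e \<in> J" using \<open>f ` slots = ears\<close> by (auto simp: ears_def)
      moreover have "snd e \<in> used (fst e)" using t \<open>v \<in> X\<close> by (auto simp: used_def)
      ultimately have "e \<in> Sigma J used" by (metis SigmaI prod.collapse)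
      then show "e \<in> {e \<in> Sigma J used. d e = v}" using t \<open>v \<in> X\<close> d by simp
    qed
    also have "card \<dots> = m v"
    proof -
      have "inj_on (\<lambda>t. f (Inl (v, t))) {..<m v}"
      proof (rule inj_onI)
        fix t t' assume "t \<in> {..<m v}" "t' \<in> {..<m v}" "f (Inl (v, t)) = f (Inl (v, t'))"
        then show "t = t'" using inj_onD[OF f(1), of "Inl (v, t)" "Inl (v, t')"] X
          by (auto simp: slots_def)
      qed
      then show ?thesis by (simp add: card_image)
    qed
    finally show ?thesis .
  qed
  show ?thesis
  proof (rule exI[of _ i\<^sub>1], rule exI[of _ i\<^sub>2], rule exI[of _ "\<lambda>j. d (j, i\<^sub>1 j)"],
      rule exI[of _ "\<lambda>j. d (j, i\<^sub>2 j)"], intro conjI ballI allI)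
    show "(\<Sum>j\<in>J. count {#d (j, i\<^sub>1 j), d (j, i\<^sub>2 j)#} v) = m v" for v by (rule cnt)
  qed (use used i12 in blast)+
qed

section \<open>Detaching a vertex\<close>

text \<open>A connected even color class in which every vertex except \<open>w\<close> has degree 2 is a bundle of closed
  walks through \<open>w\<close>. It is represented by its ears: an ear \<open>L\<close> is the list of inner vertices of
  the closed walk \<open>w, L, w\<close>, and the empty ear is a loop at \<open>w\<close>. In this representation the color
  class stays connected whatever is done to the ears.\<close>

definition walk_steps :: "'v \<Rightarrow> 'v list multiset \<Rightarrow> 'v set multiset" where
  "walk_steps w E = (\<Sum>L\<in>#E. steps (w # L @ [w]))"

text \<open>The far ends of the two edges with which an ear is attached to \<open>w\<close>; for the empty ear both are
  \<open>w\<close> itself, so that a loop contributes two half-edges.\<close>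

definition ear_ends :: "'v \<Rightarrow> 'v list \<Rightarrow> 'v multiset" where
  "ear_ends w L = {#hd (L @ [w]), last (w # L)#}"

lemma walk_steps_simps [simp]:
  "walk_steps w {#} = {#}"
  "walk_steps w (add_mset L E) = steps (w # L @ [w]) + walk_steps w E"
  "walk_steps w (E + E') = walk_steps w E + walk_steps w E'"
  by (simp_all add: walk_steps_def)

lemma count_steps_around:
  assumes "w \<notin> set L"
  shows "v \<noteq> w \<Longrightarrow> count (steps (w # L @ [w])) {w, v} = count (ear_ends w L) v"
    and "2 * count (steps (w # L @ [w])) {w} = count (ear_ends w L) w"
proof -
  have inner: "count (steps L) e = 0" if "w \<in> e" for e
    using assms steps_subset[of e L] that by (auto simp: count_eq_zero_iff)
  show "v \<noteq> w \<Longrightarrow> count (steps (w # L @ [w])) {w, v} = count (ear_ends w L) v"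
  proof (cases "L = []")
    case False
    then show ?thesis using inner[of "{w, v}"] unfolding steps_around[OF False]
      by (auto simp: ear_ends_def doubleton_eq_iff)
  qed (auto simp: ear_ends_def)
  show "2 * count (steps (w # L @ [w])) {w} = count (ear_ends w L) w"
  proof (cases "L = []")
    case False
    then have "hd L \<noteq> w" "last L \<noteq> w" using assms by auto
    then show ?thesis using inner[of "{w}"] False unfolding steps_around[OF False]
      by (auto simp: ear_ends_def doubleton_eq_iff)
  qed (simp add: ear_ends_def)
qed

lemma set_mset_sum_mset: "set_mset (\<Sum>x\<in>#M. f x) = (\<Union>x\<in>set_mset M. set_mset (f x))"
  by (induction M) auto

lemma count_sum_mset: "count (\<Sum>x\<in>#M. f x) e = (\<Sum>x\<in>#M. count (f x) e)"
  by (induction M) auto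

lemma count_walk_steps:
  assumes "\<And>L. L \<in># E \<Longrightarrow> w \<notin> set L"
  shows "v \<noteq> w \<Longrightarrow> count (walk_steps w E) {w, v} = (\<Sum>L\<in>#E. count (ear_ends w L) v)"
    and "2 * count (walk_steps w E) {w} = (\<Sum>L\<in>#E. count (ear_ends w L) w)"
  using assms by (induction E) (auto simp: count_steps_around distrib_left)

text \<open>Moving one half-edge of \<open>L\<^sub>1\<close> and one half-edge of \<open>L\<^sub>2\<close> from \<open>w\<close> to a new vertex \<open>z\<close> merges the two
  ears into one that passes through \<open>z\<close>. Both ears may be reversed, so the choice of the
  half-edges is free. The equation adds the moved edges on both sides to avoid multiset
  subtraction.\<close>

lemma join_ears:
  assumes "x\<^sub>1 \<in># ear_ends w L\<^sub>1" "x\<^sub>2 \<in># ear_ends w L\<^sub>2"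
  shows "\<exists>L. mset L = add_mset z (mset L\<^sub>1 + mset L\<^sub>2) \<and>
    steps (w # L @ [w]) + {#{w, x\<^sub>1}, {w, x\<^sub>2}#}
      = steps (w # L\<^sub>1 @ [w]) + steps (w # L\<^sub>2 @ [w]) + {#{z, x\<^sub>1}, {z, x\<^sub>2}#}"
proof -
  have rev: "steps (w # rev M @ [w]) = steps (w # M @ [w])" for M
    using steps_rev[of "w # M @ [w]"] by simp
  obtain A where A: "mset A = mset L\<^sub>1" "last (w # A) = x\<^sub>1"
    "steps (w # A @ [w]) = steps (w # L\<^sub>1 @ [w])"
  proof (cases "x\<^sub>1 = last (w # L\<^sub>1)")
    case False
    then have "last (w # rev L\<^sub>1) = x\<^sub>1"
      using assms(1) by (cases L\<^sub>1) (auto simp: ear_ends_def)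
    then show ?thesis using that[of "rev L\<^sub>1"] rev[of L\<^sub>1] by simp
  qed (use that in blast)
  obtain B where B: "mset B = mset L\<^sub>2" "hd (B @ [w]) = x\<^sub>2"
    "steps (w # B @ [w]) = steps (w # L\<^sub>2 @ [w])"
  proof (cases "x\<^sub>2 = hd (L\<^sub>2 @ [w])")
    case False
    then have "hd (rev L\<^sub>2 @ [w]) = x\<^sub>2"
      using assms(2) by (cases L\<^sub>2 rule: rev_cases) (auto simp: ear_ends_def)
    then show ?thesis using that[of "rev L\<^sub>2"] rev[of L\<^sub>2] by simp
  qed (use that in blast)
  have A': "steps (w # A @ [y]) = add_mset {y, x\<^sub>1} (steps (w # A))" for y
    using steps_snoc[of "w # A" y] A(2) by (simp add: insert_commute)
  have B': "steps (y # B @ [w]) = add_mset {y, x\<^sub>2} (steps (B @ [w]))" for y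
    using steps_Cons[of "B @ [w]" y] B(2) by simp
  have "steps (w # (A @ z # B) @ [w]) = steps (w # A @ [z]) + steps (z # B @ [w])"
    using steps_append[of "w # A" z "B @ [w]"] by simp
  then have "steps (w # (A @ z # B) @ [w]) + {#{w, x\<^sub>1}, {w, x\<^sub>2}#}
      = steps (w # A @ [w]) + steps (w # B @ [w]) + {#{z, x\<^sub>1}, {z, x\<^sub>2}#}"
    unfolding A' B' by simp
  then show ?thesis using A B by (intro exI[of _ "A @ z # B"]) simp
qed

text \<open>One detachment step: with \<open>g\<close> ears per color, a vertex \<open>z\<close> of degree 2 in every color takes over
  a \<open>g\<close>-th of the edges from \<open>w\<close> to every vertex, and a \<open>g\<close>-th of the half-edges of the loops.
  \<open>X j\<close> collects the far ends of the two half-edges that color \<open>j\<close> gives to \<open>z\<close>.\<close>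

lemma split_off_vertex:
  fixes E :: "'j \<Rightarrow> 'v list multiset"
  assumes "finite J" "2 \<le> g"
    and size: "\<And>j. j \<in> J \<Longrightarrow> size (E j) = g"
    and w: "\<And>j L. j \<in> J \<Longrightarrow> L \<in># E j \<Longrightarrow> w \<notin> set L"
    and bal: "\<And>v. v \<noteq> w \<Longrightarrow> (\<Sum>j\<in>J. count (walk_steps w (E j)) {w, v}) = g * m v"
    and loops: "2 * (\<Sum>j\<in>J. count (walk_steps w (E j)) {w}) = g * m w"
  shows "\<exists>E' X. (\<forall>j\<in>J. size (E' j) = g - 1 \<and>
      (\<Sum>L\<in>#E' j. mset L) = add_mset z (\<Sum>L\<in>#E j. mset L) \<and>
      walk_steps w (E' j) + image_mset (\<lambda>x. {w, x}) (X j)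
        = walk_steps w (E j) + image_mset (\<lambda>x. {z, x}) (X j)) \<and>
    (\<forall>v. (\<Sum>j\<in>J. count (X j) v) = m v)"
proof -
  have "\<exists>ls. mset ls = E j" for j by (rule ex_mset)
  then obtain ls where ls: "\<And>j. mset (ls j) = E j" by metis
  have len: "length (ls j) = g" if "j \<in> J" for j
    using size[OF that] ls[of j] by (metis size_mset)
  have ends: "(\<Sum>i<g. f (ls j ! i)) = (\<Sum>L\<in>#E j. f L)" if "j \<in> J" for j and f :: "'v list \<Rightarrow> nat"
  proof -
    have "(\<Sum>L\<in>#E j. f L) = sum_list (map f (ls j))"
      by (simp flip: mset_map ls add: sum_mset_sum_list)
    then show ?thesis using len[OF that] by (simp add: sum_list_sum_nth atLeast0LessThan)
  qed
  have "(\<Sum>j\<in>J. \<Sum>i<g. count (ear_ends w (ls j ! i)) v) = g * m v" for v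
  proof (cases "v = w")
    case True
    have "(\<Sum>j\<in>J. \<Sum>i<g. count (ear_ends w (ls j ! i)) v)
        = (\<Sum>j\<in>J. 2 * count (walk_steps w (E j)) {w})"
      using w True by (intro sum.cong)
        (simp_all add: ends[of _ "\<lambda>L. count (ear_ends w L) w"] count_walk_steps)
    then show ?thesis using loops True by (simp add: sum_distrib_left)
  next
    case False
    have "(\<Sum>j\<in>J. \<Sum>i<g. count (ear_ends w (ls j ! i)) v)
        = (\<Sum>j\<in>J. count (walk_steps w (E j)) {w, v})"
      using w False by (intro sum.cong)
        (simp_all add: ends[of _ "\<lambda>L. count (ear_ends w L) v"] count_walk_steps)
    then show ?thesis using bal False by simp
  qed
  from balanced_selection[OF assms(1,2) this[unfolded ear_ends_def]]
  obtain i\<^sub>1 i\<^sub>2 x\<^sub>1 x\<^sub>2 where sel: "\<And>j. j \<in> J \<Longrightarrow> i\<^sub>1 j < g \<and> i\<^sub>2 j < g \<and> i\<^sub>1 j \<noteq> i\<^sub>2 j \<and>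
      x\<^sub>1 j \<in># ear_ends w (ls j ! i\<^sub>1 j) \<and> x\<^sub>2 j \<in># ear_ends w (ls j ! i\<^sub>2 j)"
    and m: "\<And>v. (\<Sum>j\<in>J. count {#x\<^sub>1 j, x\<^sub>2 j#} v) = m v"
    unfolding ear_ends_def set_mset_add_mset_insert set_mset_empty by blast
  have "\<exists>E'. size E' = g - 1 \<and>
      (\<Sum>L\<in>#E'. mset L) = add_mset z (\<Sum>L\<in>#E j. mset L) \<and>
      walk_steps w E' + image_mset (\<lambda>x. {w, x}) {#x\<^sub>1 j, x\<^sub>2 j#}
        = walk_steps w (E j) + image_mset (\<lambda>x. {z, x}) {#x\<^sub>1 j, x\<^sub>2 j#}" if j: "j \<in> J" for j
  proof -
    define L\<^sub>1 L\<^sub>2 where "L\<^sub>1 = ls j ! i\<^sub>1 j" and "L\<^sub>2 = ls j ! i\<^sub>2 j"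
    have "{#L\<^sub>1, L\<^sub>2#} \<subseteq># E j"
    proof -
      have "image_mset ((!) (ls j)) (mset_set {i\<^sub>1 j, i\<^sub>2 j})
          \<subseteq># image_mset ((!) (ls j)) (mset_set {..<g})"
        using sel[OF j] by (intro image_mset_subseteq_mono subset_imp_msubset_mset_set) auto
      also have "\<dots> = mset (map ((!) (ls j)) [0..<g])"
        by (simp add: atLeast0LessThan)
      also have "map ((!) (ls j)) [0..<g] = ls j" using len[OF j] map_nth by metis
      finally show ?thesis using sel[OF j] by (simp add: L\<^sub>1_def L\<^sub>2_def ls)
    qed
    then obtain R where R: "E j = {#L\<^sub>1, L\<^sub>2#} + R" by (metis subset_mset.le_iff_add)
    obtain L where L: "mset L = add_mset z (mset L\<^sub>1 + mset L\<^sub>2)"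
      "steps (w # L @ [w]) + {#{w, x\<^sub>1 j}, {w, x\<^sub>2 j}#}
        = steps (w # L\<^sub>1 @ [w]) + steps (w # L\<^sub>2 @ [w]) + {#{z, x\<^sub>1 j}, {z, x\<^sub>2 j}#}"
      using join_ears[of "x\<^sub>1 j" w L\<^sub>1 "x\<^sub>2 j" L\<^sub>2 z] sel[OF j] by (auto simp: L\<^sub>1_def L\<^sub>2_def)
    have "walk_steps w (add_mset L R) + {#{w, x\<^sub>1 j}, {w, x\<^sub>2 j}#}
        = (steps (w # L @ [w]) + {#{w, x\<^sub>1 j}, {w, x\<^sub>2 j}#}) + walk_steps w R"
      by (simp del: steps.simps)
    also have "\<dots> = walk_steps w (E j) + {#{z, x\<^sub>1 j}, {z, x\<^sub>2 j}#}"
      unfolding L(2) R by (simp del: steps.simps)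
    finally show ?thesis
      using L(1) R size[OF j] by (intro exI[of _ "add_mset L R"]) (simp del: walk_steps_simps)
  qed
  then obtain E' where "\<And>j. j \<in> J \<Longrightarrow> size (E' j) = g - 1 \<and>
      (\<Sum>L\<in>#E' j. mset L) = add_mset z (\<Sum>L\<in>#E j. mset L) \<and>
      walk_steps w (E' j) + image_mset (\<lambda>x. {w, x}) {#x\<^sub>1 j, x\<^sub>2 j#}
        = walk_steps w (E j) + image_mset (\<lambda>x. {z, x}) {#x\<^sub>1 j, x\<^sub>2 j#}"
    by metis
  then show ?thesis using m
    by (intro exI[of _ E'] exI[of _ "\<lambda>j. {#x\<^sub>1 j, x\<^sub>2 j#}"]) blast
qed

lemma count_image_doubleton: "count (image_mset (\<lambda>x. {w, x}) X) {w, v} = count X v"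
  by (induction X) (auto simp: doubleton_eq_iff)

lemma count_image_doubleton_other:
  "w \<notin> e \<Longrightarrow> count (image_mset (\<lambda>x. {w, x}) X) e = 0"
  by (induction X) auto

text \<open>Iterating the step until a single ear per color is left turns \<open>w\<close> into \<open>g\<close> vertices, of which \<open>w\<close>
  itself is the last, and each color class into one cycle. The number \<open>b * g * (g - 1) / 2\<close> of loops
  is what \<open>b\<close> edges between any two of the \<open>g\<close> vertices amount to. After one step the count has the
  same form for \<open>g - 1\<close>, and the new vertex joins the old ones with \<open>m z = b\<close>.\<close>

theorem detachment:
  fixes E :: "'j \<Rightarrow> 'v list multiset"
  assumes "finite J" "1 \<le> g"
    and "\<And>j. j \<in> J \<Longrightarrow> size (E j) = g"
    and "\<And>j. j \<in> J \<Longrightarrow> (\<Sum>L\<in>#E j. mset L) = mset_set V"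
    and "finite V" "w \<notin> V"
    and "\<And>v. v \<in> V \<Longrightarrow> (\<Sum>j\<in>J. count (walk_steps w (E j)) {w, v}) = g * m v"
    and "2 * (\<Sum>j\<in>J. count (walk_steps w (E j)) {w}) = b * g * (g - 1)"
    and "finite Z" "card Z = g - 1" "Z \<inter> insert w V = {}"
  shows "\<exists>L. (\<forall>j\<in>J. mset (L j) = mset_set (V \<union> Z) \<and>
        (\<forall>u\<in>V. \<forall>v\<in>V. count (steps (w # L j @ [w])) {u, v} = count (walk_steps w (E j)) {u, v})) \<and>
      (\<forall>z\<in>insert w Z. \<forall>v\<in>V. (\<Sum>j\<in>J. count (steps (w # L j @ [w])) {z, v}) = m v) \<and>
      (\<forall>z\<in>insert w Z. \<forall>z'\<in>insert w Z. z \<noteq> z' \<longrightarrow>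
        (\<Sum>j\<in>J. count (steps (w # L j @ [w])) {z, z'}) = b)"
  using assms(2-)
proof (induction g arbitrary: E V m Z rule: less_induct)
  case (less g)
  note size = less.prems(2) and cover = less.prems(3) and V = less.prems(4,5)
    and bal = less.prems(6) and loops = less.prems(7) and Z = less.prems(8-10)
  have set_E: "set L \<subseteq> V" if "j \<in> J" "L \<in># E j" for j L
  proof -
    have "set_mset (\<Sum>L\<in>#E j. mset L) = V" using cover[OF that(1)] V(1) by simp
    then show ?thesis using that(2) by (auto simp: set_mset_sum_mset)
  qed
  show ?case
  proof (cases "g = 1")
    case True
    then have "\<exists>L. E j = {#L#}" if "j \<in> J" for j
      using size[OF that] size_1_singleton_mset by auto
    then obtain L where L: "\<And>j. j \<in> J \<Longrightarrow> E j = {#L j#}" by metis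
    have "Z = {}" using Z True by simp
    then show ?thesis using L cover bal True
      by (intro exI[of _ L]) (auto simp del: steps.simps)
  next
    case False
    then have g: "2 \<le> g" using less.prems(1) by simp
    then have "Z \<noteq> {}" using Z(2) by auto
    then obtain z where z: "z \<in> Z" by blast
    then have zV: "z \<notin> V" "z \<noteq> w" using Z(3) by auto
    \<comment> \<open>The number of half-edges towards \<open>v\<close> that \<open>z\<close> receives; towards \<open>w\<close> these are halves of loops.\<close>
    define m' where "m' v = (if v = w then b * (g - 1) else if v \<in> V then m v else 0)" for v
    have "\<exists>E' X. (\<forall>j\<in>J. size (E' j) = g - 1 \<and>
        (\<Sum>L\<in>#E' j. mset L) = add_mset z (\<Sum>L\<in>#E j. mset L) \<and>
        walk_steps w (E' j) + image_mset (\<lambda>x. {w, x}) (X j)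
          = walk_steps w (E j) + image_mset (\<lambda>x. {z, x}) (X j)) \<and>
      (\<forall>v. (\<Sum>j\<in>J. count (X j) v) = m' v)"
    proof (rule split_off_vertex[OF assms(1) g])
      show "w \<notin> set L" if "j \<in> J" "L \<in># E j" for j L using set_E[OF that] V by blast
      show "2 * (\<Sum>j\<in>J. count (walk_steps w (E j)) {w}) = g * m' w"
        using loops by (simp add: m'_def mult_ac)
      fix v assume "v \<noteq> w"
      show "(\<Sum>j\<in>J. count (walk_steps w (E j)) {w, v}) = g * m' v"
      proof (cases "v \<in> V")
        case True
        then show ?thesis using bal \<open>v \<noteq> w\<close> by (simp add: m'_def)
      next
        case v: False
        have "count (walk_steps w (E j)) {w, v} = 0" if "j \<in> J" for j
        proof -
          have "{w, v} \<notin># steps (w # L @ [w])" if "L \<in># E j" for L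
          proof
            assume "{w, v} \<in># steps (w # L @ [w])"
            then have "{w, v} \<subseteq> set (w # L @ [w])" by (rule steps_subset)
            then show False using v \<open>v \<noteq> w\<close> set_E[OF \<open>j \<in> J\<close> that] by auto
          qed
          then show ?thesis
            by (auto simp: walk_steps_def count_eq_zero_iff set_mset_sum_mset simp del: steps.simps)
        qed
        then show ?thesis using v \<open>v \<noteq> w\<close> by (simp add: m'_def)
      qed
    qed (use size in auto)
    then obtain E' X where E': "\<And>j. j \<in> J \<Longrightarrow> size (E' j) = g - 1"
        "\<And>j. j \<in> J \<Longrightarrow> (\<Sum>L\<in>#E' j. mset L) = add_mset z (\<Sum>L\<in>#E j. mset L)"
        "\<And>j. j \<in> J \<Longrightarrow> walk_steps w (E' j) + image_mset (\<lambda>x. {w, x}) (X j)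
          = walk_steps w (E j) + image_mset (\<lambda>x. {z, x}) (X j)"
      and X: "\<And>v. (\<Sum>j\<in>J. count (X j) v) = m' v" by blast
    have cnt: "count (walk_steps w (E' j)) e + count (image_mset (\<lambda>x. {w, x}) (X j)) e
          = count (walk_steps w (E j)) e + count (image_mset (\<lambda>x. {z, x}) (X j)) e"
      if "j \<in> J" for j e
      using E'(3)[OF that] by (metis count_union)
    have old: "count (walk_steps w (E' j)) e = count (walk_steps w (E j)) e"
      if "j \<in> J" "z \<notin> e" "w \<notin> e" for j e
      using cnt[OF that(1), of e] that by (simp add: count_image_doubleton_other)
    have z0: "count (walk_steps w (E j)) e = 0" if "j \<in> J" "z \<in> e" for j e
    proof -
      have "e \<notin># steps (w # L @ [w])" if "L \<in># E j" for L
      proof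
        assume "e \<in># steps (w # L @ [w])"
        then have "e \<subseteq> set (w # L @ [w])" by (rule steps_subset)
        then show False using \<open>z \<in> e\<close> zV set_E[OF \<open>j \<in> J\<close> that] by auto
      qed
      then show ?thesis
        by (auto simp: walk_steps_def count_eq_zero_iff set_mset_sum_mset simp del: steps.simps)
    qed
    have zv: "(\<Sum>j\<in>J. count (walk_steps w (E' j)) {z, v}) = m v" if "v \<in> V" for v
    proof -
      have "(\<Sum>j\<in>J. count (walk_steps w (E' j)) {z, v}) = (\<Sum>j\<in>J. count (X j) v)"
      proof (rule sum.cong[OF refl])
        fix j assume "j \<in> J"
        moreover have "w \<notin> {z, v}" using zV that V(2) by auto
        ultimately show "count (walk_steps w (E' j)) {z, v} = count (X j) v"
          using cnt[of j "{z, v}"] z0[of j "{z, v}"]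
          by (simp add: count_image_doubleton_other count_image_doubleton)
      qed
      then show ?thesis using X that V by (auto simp: m'_def)
    qed
    have wz: "(\<Sum>j\<in>J. count (walk_steps w (E' j)) {w, z}) = b * (g - 1)"
    proof -
      have "(\<Sum>j\<in>J. count (walk_steps w (E' j)) {w, z}) + (\<Sum>j\<in>J. count (X j) z)
          = (\<Sum>j\<in>J. count (X j) w)"
        unfolding sum.distrib[symmetric]
      proof (rule sum.cong[OF refl])
        fix j assume "j \<in> J"
        then show "count (walk_steps w (E' j)) {w, z} + count (X j) z = count (X j) w"
          using cnt[of j "{w, z}"] z0[of j "{w, z}"] count_image_doubleton[of w "X j" z]
            count_image_doubleton[of z "X j" w]
          by (simp add: insert_commute)
      qed
      then show ?thesis using X[of z] X[of w] zV by (simp add: m'_def)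
    qed
    have wv: "(\<Sum>j\<in>J. count (walk_steps w (E' j)) {w, v}) = (g - 1) * m v" if "v \<in> V" for v
    proof -
      have "(\<Sum>j\<in>J. count (walk_steps w (E' j)) {w, v}) + (\<Sum>j\<in>J. count (X j) v)
          = (\<Sum>j\<in>J. count (walk_steps w (E j)) {w, v})"
        unfolding sum.distrib[symmetric]
      proof (rule sum.cong[OF refl])
        fix j assume "j \<in> J"
        moreover have "z \<notin> {w, v}" using zV that by auto
        ultimately show "count (walk_steps w (E' j)) {w, v} + count (X j) v
            = count (walk_steps w (E j)) {w, v}"
          using cnt[of j "{w, v}"] by (simp add: count_image_doubleton_other count_image_doubleton)
      qed
      moreover have "v \<noteq> w" using that V by auto
      ultimately show ?thesis using X[of v] bal[OF that] that g
        by (simp add: m'_def diff_mult_distrib)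
    qed
    have ww: "2 * (\<Sum>j\<in>J. count (walk_steps w (E' j)) {w}) = b * (g - 1) * (g - 1 - 1)"
    proof -
      have "(\<Sum>j\<in>J. count (walk_steps w (E' j)) {w}) + (\<Sum>j\<in>J. count (X j) w)
          = (\<Sum>j\<in>J. count (walk_steps w (E j)) {w})"
        unfolding sum.distrib[symmetric]
      proof (rule sum.cong[OF refl])
        fix j assume "j \<in> J"
        moreover have "z \<notin> {w}" using zV by auto
        ultimately show "count (walk_steps w (E' j)) {w} + count (X j) w
            = count (walk_steps w (E j)) {w}"
          using cnt[of j "{w}"] count_image_doubleton[of w "X j" w]
          by (simp add: count_image_doubleton_other)
      qed
      then have "2 * (\<Sum>j\<in>J. count (walk_steps w (E' j)) {w}) + 2 * (b * (g - 1)) = b * g * (g - 1)"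
        using X[of w] loops by (simp add: m'_def)
      moreover obtain q where "g = Suc (Suc q)" using g by (metis add_2_eq_Suc le_Suc_ex)
      ultimately show ?thesis by (simp add: algebra_simps)
    qed
    have "\<exists>L. (\<forall>j\<in>J. mset (L j) = mset_set (insert z V \<union> (Z - {z})) \<and>
        (\<forall>u\<in>insert z V. \<forall>v\<in>insert z V.
          count (steps (w # L j @ [w])) {u, v} = count (walk_steps w (E' j)) {u, v})) \<and>
      (\<forall>y\<in>insert w (Z - {z}). \<forall>v\<in>insert z V.
        (\<Sum>j\<in>J. count (steps (w # L j @ [w])) {y, v}) = (m(z := b)) v) \<and>
      (\<forall>y\<in>insert w (Z - {z}). \<forall>y'\<in>insert w (Z - {z}). y \<noteq> y' \<longrightarrow>
        (\<Sum>j\<in>J. count (steps (w # L j @ [w])) {y, y'}) = b)"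
    proof (rule less.IH[of "g - 1" E' "insert z V" "m(z := b)" "Z - {z}"])
      show "g - 1 < g" "1 \<le> g - 1" using g by auto
      show "(\<Sum>L\<in>#E' j. mset L) = mset_set (insert z V)" if "j \<in> J" for j
        using E'(2)[OF that] cover[OF that] V zV by simp
      show "w \<notin> insert z V" using V zV by auto
      show "(\<Sum>j\<in>J. count (walk_steps w (E' j)) {w, v}) = (g - 1) * (m(z := b)) v"
        if "v \<in> insert z V" for v
        using that wz wv zV by (auto simp: mult.commute)
      show "card (Z - {z}) = g - 1 - 1" using z Z by simp
      show "(Z - {z}) \<inter> insert w (insert z V) = {}" using Z by auto
      show "size (E' j) = g - 1" if "j \<in> J" for j by (rule E'(1)[OF that])
      show "finite (insert z V)" "finite (Z - {z})" using V Z by auto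
      show "2 * (\<Sum>j\<in>J. count (walk_steps w (E' j)) {w}) = b * (g - 1) * (g - 1 - 1)" by (rule ww)
    qed
    then obtain L where
      L12: "\<forall>j\<in>J. mset (L j) = mset_set (insert z V \<union> (Z - {z})) \<and>
        (\<forall>u\<in>insert z V. \<forall>v\<in>insert z V.
          count (steps (w # L j @ [w])) {u, v} = count (walk_steps w (E' j)) {u, v})"
      and L3: "\<forall>y\<in>insert w (Z - {z}). \<forall>v\<in>insert z V.
        (\<Sum>j\<in>J. count (steps (w # L j @ [w])) {y, v}) = (m(z := b)) v"
      and L4: "\<forall>y\<in>insert w (Z - {z}). \<forall>y'\<in>insert w (Z - {z}). y \<noteq> y' \<longrightarrow>
        (\<Sum>j\<in>J. count (steps (w # L j @ [w])) {y, y'}) = b"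
      by (elim exE conjE) (rule that)
    have L: "\<And>j. j \<in> J \<Longrightarrow> mset (L j) = mset_set (insert z V \<union> (Z - {z}))"
      "\<And>j u v. j \<in> J \<Longrightarrow> u \<in> insert z V \<Longrightarrow> v \<in> insert z V \<Longrightarrow>
          count (steps (w # L j @ [w])) {u, v} = count (walk_steps w (E' j)) {u, v}"
      "\<And>y v. y \<in> insert w (Z - {z}) \<Longrightarrow> v \<in> insert z V \<Longrightarrow>
        (\<Sum>j\<in>J. count (steps (w # L j @ [w])) {y, v}) = (m(z := b)) v"
      "\<And>y y'. y \<in> insert w (Z - {z}) \<Longrightarrow> y' \<in> insert w (Z - {z}) \<Longrightarrow> y \<noteq> y' \<Longrightarrow>
        (\<Sum>j\<in>J. count (steps (w # L j @ [w])) {y, y'}) = b"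
      by (rule conjunct1[OF bspec[OF L12]], assumption)
        (rule bspec[OF bspec[OF conjunct2[OF bspec[OF L12]]]] bspec[OF bspec[OF L3]]
          mp[OF bspec[OF bspec[OF L4]]]; assumption)+
    have zb: "(\<Sum>j\<in>J. count (steps (w # L j @ [w])) {y, z}) = b"
      if "y \<in> insert w Z" "y \<noteq> z" for y
      using L(3)[of y z] that by simp
    show ?thesis
    proof (intro exI[of _ L] conjI ballI impI)
      show "mset (L j) = mset_set (V \<union> Z)" if "j \<in> J" for j
      proof -
        have "insert z V \<union> (Z - {z}) = V \<union> Z" using z by auto
        then show ?thesis using L(1)[OF that] by simp
      qed
      show "count (steps (w # L j @ [w])) {u, v} = count (walk_steps w (E j)) {u, v}"
        if "j \<in> J" "u \<in> V" "v \<in> V" for j u v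
        using L(2)[OF that(1), of u v] old[OF that(1), of "{u, v}"] that zV V by auto
      show "(\<Sum>j\<in>J. count (steps (w # L j @ [w])) {y, v}) = m v"
        if "y \<in> insert w Z" "v \<in> V" for y v
      proof (cases "y = z")
        case True
        have "(\<Sum>j\<in>J. count (steps (w # L j @ [w])) {z, v})
            = (\<Sum>j\<in>J. count (walk_steps w (E' j)) {z, v})"
          using that by (intro sum.cong refl L(2)) auto
        then show ?thesis using zv that True by simp
      next
        case False
        then show ?thesis using L(3)[of y v] that zV by auto
      qed
      show "(\<Sum>j\<in>J. count (steps (w # L j @ [w])) {y, y'}) = b"
        if "y \<in> insert w Z" "y' \<in> insert w Z" "y \<noteq> y'" for y y'
      proof -
        consider "y' = z" | "y = z" | "y \<noteq> z" "y' \<noteq> z" by blast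
        then show ?thesis
        proof cases
          case 2
          then show ?thesis using zb[of y'] that by (simp add: insert_commute del: steps.simps)
        qed (use zb L(4) that in auto)
      qed
    qed
  qed
qed

section \<open>Paths, cycles and linear forests\<close>

text \<open>A multiset of end sets determines an enumeration of the edges themselves. This connects the
  definitions of paths and cycles with the multisets of steps.\<close>

lemma mset_eq_image_mset_set:
  assumes "mset ys = image_mset f (mset_set F)" "finite F"
  obtains es where "distinct es" "set es = F" "map f es = ys"
proof -
  have "\<exists>xs. mset xs = M \<and> map f xs = ys" if "mset ys = image_mset f M" for M ys
    using that
  proof (induction ys arbitrary: M)
    case (Cons y ys)
    then obtain M' x where "M = add_mset x M'" "f x = y" "image_mset f M' = mset ys"
      using msed_map_invR[of f M y "mset ys"] by auto
    moreover from this obtain xs where "mset xs = M'" "map f xs = ys"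
      using Cons.IH[of M'] by auto
    ultimately show ?case by (intro exI[of _ "x # xs"]) simp
  qed simp
  then obtain es where es: "mset es = mset_set F" "map f es = ys" using assms(1) by blast
  have "set es = F" using es(1) assms(2) by (metis finite_set_mset_mset_set set_mset_mset)
  moreover have "distinct es" using es(1) calculation
    by (metis mset_set_set mset_eq_imp_distinct_iff finite_distinct_list assms(2))
  ultimately show thesis using that es(2) by blast
qed

lemma is_path_iff:
  "is_path G \<longleftrightarrow> finite (edges G) \<and> (\<exists>xs. xs \<noteq> [] \<and> distinct xs \<and> set xs = verts G \<and>
    image_mset (ends G) (mset_set (edges G)) = steps xs)"
proof
  assume "is_path G"
  then obtain xs es where *: "distinct xs" "set xs = verts G" "distinct es" "set es = edges G"
     "length xs = Suc (length es)" "\<forall>i<length es. ends G (es ! i) = {xs ! i, xs ! Suc i}"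
    unfolding is_path_def by blast
  have "map (ends G) es = map (\<lambda>i. {xs ! i, xs ! Suc i}) [0..<length xs - 1]"
    using * by (intro nth_equalityI) auto
  then have "image_mset (ends G) (mset es) = steps xs" by (simp add: steps_conv_nth flip: mset_map)
  then show "finite (edges G) \<and> (\<exists>xs. xs \<noteq> [] \<and> distinct xs \<and> set xs = verts G \<and>
      image_mset (ends G) (mset_set (edges G)) = steps xs)"
    using * mset_set_set[OF *(3)] finite_set[of es] by (intro conjI exI[of _ xs]) auto
next
  assume "finite (edges G) \<and> (\<exists>xs. xs \<noteq> [] \<and> distinct xs \<and> set xs = verts G \<and>
      image_mset (ends G) (mset_set (edges G)) = steps xs)"
  then obtain xs where *: "finite (edges G)" "xs \<noteq> []" "distinct xs" "set xs = verts G"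
    "mset (map (\<lambda>i. {xs ! i, xs ! Suc i}) [0..<length xs - 1])
      = image_mset (ends G) (mset_set (edges G))"
    by (auto simp: steps_conv_nth)
  obtain es where es: "distinct es" "set es = edges G"
    "map (ends G) es = map (\<lambda>i. {xs ! i, xs ! Suc i}) [0..<length xs - 1]"
    using mset_eq_image_mset_set[OF *(5,1)] .
  have "length es = length xs - 1" using arg_cong[OF es(3), of length] by simp
  moreover have "ends G (es ! i) = {xs ! i, xs ! Suc i}" if "i < length es" for i
    using arg_cong[OF es(3), of "\<lambda>l. l ! i"] that calculation by simp
  ultimately show "is_path G" using * es unfolding is_path_def
    by (intro exI[of _ xs] exI[of _ es]) auto
qed

lemma is_cycle_iff:
  "is_cycle G \<longleftrightarrow> finite (edges G) \<and> (\<exists>xs. 2 \<le> length xs \<and> distinct xs \<and> set xs = verts G \<and>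
    image_mset (ends G) (mset_set (edges G)) = closed_steps xs)"
proof
  assume "is_cycle G"
  then obtain xs es where *: "distinct xs" "set xs = verts G" "distinct es" "set es = edges G"
     "length xs = length es" "2 \<le> length es"
     "\<forall>i<length es. ends G (es ! i) = {xs ! i, xs ! (Suc i mod length es)}"
    unfolding is_cycle_def by blast
  have "map (ends G) es = map (\<lambda>i. {xs ! i, xs ! (Suc i mod length xs)}) [0..<length xs]"
    using * by (intro nth_equalityI) auto
  then have "image_mset (ends G) (mset es) = closed_steps xs"
    by (simp add: closed_steps_conv_nth flip: mset_map)
  then show "finite (edges G) \<and> (\<exists>xs. 2 \<le> length xs \<and> distinct xs \<and> set xs = verts G \<and>
      image_mset (ends G) (mset_set (edges G)) = closed_steps xs)"
    using * mset_set_set[OF *(3)] finite_set[of es] by (intro conjI exI[of _ xs]) auto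
next
  assume "finite (edges G) \<and> (\<exists>xs. 2 \<le> length xs \<and> distinct xs \<and> set xs = verts G \<and>
      image_mset (ends G) (mset_set (edges G)) = closed_steps xs)"
  then obtain xs where *: "finite (edges G)" "2 \<le> length xs" "distinct xs" "set xs = verts G"
    "mset (map (\<lambda>i. {xs ! i, xs ! (Suc i mod length xs)}) [0..<length xs])
      = image_mset (ends G) (mset_set (edges G))"
    by (auto simp: closed_steps_conv_nth)
  obtain es where es: "distinct es" "set es = edges G"
    "map (ends G) es = map (\<lambda>i. {xs ! i, xs ! (Suc i mod length xs)}) [0..<length xs]"
    using mset_eq_image_mset_set[OF *(5,1)] .
  have "length es = length xs" using arg_cong[OF es(3), of length] by simp
  moreover have "ends G (es ! i) = {xs ! i, xs ! (Suc i mod length xs)}" if "i < length es" for i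
    using arg_cong[OF es(3), of "\<lambda>l. l ! i"] that calculation by simp
  ultimately show "is_cycle G" using * es unfolding is_cycle_def
    by (intro exI[of _ xs] exI[of _ es]) auto
qed

text \<open>The lists \<open>Ls\<close> are the maximal runs of consecutive vertices in \<open>S\<close>.\<close>

lemma steps_runs:
  "\<exists>Ls. [] \<notin> set Ls \<and> concat Ls = filter (\<lambda>x. x \<in> S) ys \<and>
    filter_mset (\<lambda>e. e \<subseteq> S) (steps ys) = (\<Sum>L\<leftarrow>Ls. steps L)"
proof (induction ys rule: steps.induct)
  case (1 x y xs)
  then obtain Ls where Ls: "[] \<notin> set Ls" "concat Ls = filter (\<lambda>x. x \<in> S) (y # xs)"
    "filter_mset (\<lambda>e. e \<subseteq> S) (steps (y # xs)) = (\<Sum>L\<leftarrow>Ls. steps L)" by blast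
  consider "x \<notin> S" | "x \<in> S" "y \<notin> S" | (both) "x \<in> S" "y \<in> S" by blast
  then show ?case
  proof cases
    case both
    then obtain L Ls' where L: "Ls = L # Ls'" using Ls(2) by (cases Ls) auto
    then obtain L' where L': "L = y # L'" using Ls(1,2) both by (cases L) auto
    show ?thesis using Ls both unfolding L L'
      by (intro exI[of _ "(x # y # L') # Ls'"]) auto
  next
    case 2
    then show ?thesis using Ls by (intro exI[of _ "[x] # Ls"]) auto
  qed (use Ls in auto)
next
  case ("2_2" x)
  show ?case
  proof (cases "x \<in> S")
    case True
    then show ?thesis by (intro exI[of _ "[[x]]"]) simp
  qed (auto intro: exI[of _ "[]"])
qed (auto intro: exI[of _ "[]"])

text \<open>Cutting a cycle at a vertex outside \<open>S\<close> shows that its restriction to \<open>S\<close> is a disjoint union of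
  paths.\<close>

lemma closed_steps_runs:
  assumes "\<not> set xs \<subseteq> S" "distinct xs"
  obtains Ls where "[] \<notin> set Ls" "distinct (concat Ls)" "set (concat Ls) = set xs \<inter> S"
    "filter_mset (\<lambda>e. e \<subseteq> S) (closed_steps xs) = (\<Sum>L\<leftarrow>Ls. steps L)"
proof -
  obtain w where w: "w \<in> set xs" "w \<notin> S" using assms(1) by blast
  obtain L where L: "mset xs = mset (w # L)" "closed_steps xs = steps (w # L @ [w])"
    using closed_steps_rotate[OF w(1)] .
  have "distinct (w # L)" using L(1) assms(2) mset_eq_imp_distinct_iff by blast
  moreover have "set xs = set (w # L)" using L(1) mset_eq_setD by blast
  moreover have "filter_mset (\<lambda>e. e \<subseteq> S) (closed_steps xs) = filter_mset (\<lambda>e. e \<subseteq> S) (steps L)"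
  proof (cases "L = []")
    case False
    then show ?thesis unfolding L(2) steps_around[OF False] using w(2) by simp
  qed (use L(2) w(2) in simp)
  moreover obtain Ls where Ls: "[] \<notin> set Ls" "concat Ls = filter (\<lambda>x. x \<in> S) L"
    "filter_mset (\<lambda>e. e \<subseteq> S) (steps L) = (\<Sum>L\<leftarrow>Ls. steps L)"
    using steps_runs[of S L] by blast
  ultimately show thesis using that[OF Ls(1)] w(2) unfolding Ls(2) by auto
qed

lemma size_steps_runs:
  assumes "[] \<notin> set Ls"
  shows "size (\<Sum>L\<leftarrow>Ls. steps L) + length Ls = length (concat Ls)"
  using assms
proof (induction Ls)
  case (Cons L Ls)
  then show ?case by (cases L) (simp_all add: size_steps)
qed simp

lemma size_filter_add_runs:
  assumes "[] \<notin> set Ls" "distinct (concat Ls)" "M = (\<Sum>L\<leftarrow>Ls. steps L)"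
  shows "size M + length Ls = card (set (concat Ls))"
  using size_steps_runs[OF assms(1)] distinct_card[OF assms(2)] assms(3) by simp

text \<open>The number of vertices minus the number of edges is the same for the restrictions of a cycle to
  \<open>S\<close> and to its complement: as all degrees are 2, both equal half the number of edges between the
  two sides. Together with the decomposition into runs, this says that the two restrictions have
  equally many components.\<close>

lemma edge_count_complement:
  assumes "distinct xs" "2 \<le> length xs" "S \<subseteq> set xs"
  shows "size (filter_mset (\<lambda>e. e \<subseteq> S) (closed_steps xs)) + card (set xs - S)
       = size (filter_mset (\<lambda>e. e \<subseteq> set xs - S) (closed_steps xs)) + card S"
proof -
  define M where "M = closed_steps xs"
  have deg: "(\<Sum>e\<in>#M. card (e \<inter> T)) = 2 * card T" if "T \<subseteq> set xs" for T
  proof -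
    have fin: "finite T" using that finite_subset by blast
    have "(\<Sum>e\<in>#M. card (e \<inter> T)) = (\<Sum>e\<in>#M. \<Sum>v\<in>T. if v \<in> e then 1 else 0)"
      using fin by (intro arg_cong[of _ _ sum_mset] image_mset_cong)
        (simp add: sum.If_cases Int_commute)
    also have "\<dots> = (\<Sum>v\<in>T. \<Sum>e\<in>#M. if v \<in> e then 1 else 0)"
      by (induction M) (simp_all add: sum.distrib)
    also have "\<dots> = (\<Sum>v\<in>T. degree_in M v)"
    proof (rule sum.cong[OF refl])
      show "(\<Sum>e\<in>#M. if v \<in> e then 1 else 0) = degree_in M v" for v
        by (induction M) simp_all
    qed
    also have "\<dots> = (\<Sum>v\<in>T. 2)"
      unfolding M_def using degree_in_closed_steps[OF assms(1,2)] that
      by (intro sum.cong) auto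
    finally show ?thesis by simp
  qed
  have "2 * size (filter_mset (\<lambda>e. e \<subseteq> S) M) + (\<Sum>e\<in>#M. card (e \<inter> (set xs - S)))
      = 2 * size (filter_mset (\<lambda>e. e \<subseteq> set xs - S) M) + (\<Sum>e\<in>#M. card (e \<inter> S))"
    if "\<And>e. e \<in># M \<Longrightarrow> e \<subseteq> set xs \<and> card e = 2" for M
    using that
  proof (induction M)
    case (add e M)
    have e: "e \<subseteq> set xs" "card e = 2" using add.prems by auto
    have fin: "finite e" using e(1) finite_subset by blast
    have split: "card (e \<inter> S) + card (e \<inter> (set xs - S)) = 2"
    proof -
      have "card (e \<inter> S) + card (e \<inter> (set xs - S)) = card ((e \<inter> S) \<union> (e \<inter> (set xs - S)))"
        using fin by (subst card_Un_disjoint) auto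
      also have "(e \<inter> S) \<union> (e \<inter> (set xs - S)) = e" using e by auto
      finally show ?thesis using e by simp
    qed
    define a b where "a = card (e \<inter> S)" and "b = card (e \<inter> (set xs - S))"
    have iff: "e \<subseteq> S \<longleftrightarrow> b = 0" "e \<subseteq> set xs - S \<longleftrightarrow> a = 0"
      using fin e by (auto simp: a_def b_def)
    \<comment> \<open>Every edge \<open>e\<close> changes both sides by the same amount, whether it lies inside \<open>S\<close> (\<open>a = 2\<close>),
        across (\<open>a = 1\<close>), or inside the complement (\<open>a = 0\<close>).\<close>
    have IH: "2 * size (filter_mset (\<lambda>e. e \<subseteq> S) M) + (\<Sum>e\<in>#M. card (e \<inter> (set xs - S)))
        = 2 * size (filter_mset (\<lambda>e. e \<subseteq> set xs - S) M) + (\<Sum>e\<in>#M. card (e \<inter> S))"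
      using add by simp
    have "a = 0 \<and> b = 2 \<or> a = 1 \<and> b = 1 \<or> a = 2 \<and> b = 0"
      using split unfolding a_def b_def by linarith
    then have ab: "2 * (if b = 0 then 1 else 0) + b = 2 * (if a = 0 then 1 else 0) + a" by auto
    have sz: "size (filter_mset (\<lambda>e. e \<subseteq> S) (add_mset e M))
        = (if b = 0 then 1 else 0) + size (filter_mset (\<lambda>e. e \<subseteq> S) M)"
      "size (filter_mset (\<lambda>e. e \<subseteq> set xs - S) (add_mset e M))
        = (if a = 0 then 1 else 0) + size (filter_mset (\<lambda>e. e \<subseteq> set xs - S) M)"
      unfolding iff(1)[symmetric] iff(2)[symmetric] by simp_all
    show ?case
      unfolding sz image_mset_add_mset sum_mset.add_mset a_def[symmetric] b_def[symmetric]
        distrib_left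
      using IH ab by linarith
  qed simp
  from this[of M] have "2 * size (filter_mset (\<lambda>e. e \<subseteq> S) M) + 2 * card (set xs - S)
      = 2 * size (filter_mset (\<lambda>e. e \<subseteq> set xs - S) M) + 2 * card S"
    using closed_steps_subset[of _ xs] closed_steps_distinct_card[OF assms(1,2)]
    unfolding deg[OF Diff_subset] deg[OF assms(3)] by (simp add: M_def)
  then show ?thesis by (simp add: M_def)
qed

section \<open>Components\<close>

lemma steps_connected:
  assumes "set_mset (steps xs) \<subseteq> ends G ` edges G" "u \<in> set xs" "v \<in> set xs"
  shows "(u, v) \<in> (adjacency G)\<^sup>*"
proof -
  have sym: "sym ((adjacency G)\<^sup>*)"
    by (rule sym_rtrancl) (auto simp: sym_def adjacency_def insert_commute)
  have hd: "(hd xs, v) \<in> (adjacency G)\<^sup>*" if "v \<in> set xs" for v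
    using assms(1) that
  proof (induction xs rule: steps.induct)
    case (1 x y xs)
    have "(x, y) \<in> adjacency G" using "1.prems" by (auto simp: adjacency_def)
    then show ?case using 1 by (auto intro: converse_rtrancl_into_rtrancl)
  qed auto
  show ?thesis using hd[OF assms(2)] hd[OF assms(3)] sym
    by (meson rtrancl_trans symD)
qed

text \<open>No edge leaves the path in which it is a step, and each path is connected, so the connectivity
  classes are the vertex sets of the paths.\<close>

lemma linear_forest_components:
  fixes G :: "('v, 'e) multigraph"
  assumes "finite (edges G)" "[] \<notin> set Ls" "distinct (concat Ls)" "set (concat Ls) = verts G"
    and edges: "image_mset (ends G) (mset_set (edges G)) = (\<Sum>L\<leftarrow>Ls. steps L)"
  shows "\<forall>C\<in>components G. is_path C" "num_components G = length Ls"
proof -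
  have set_sum: "e \<in># (\<Sum>L\<leftarrow>Ls. steps L) \<longleftrightarrow> (\<exists>L\<in>set Ls. e \<in># steps L)" for e and Ls :: "'v list list"
    by (induction Ls) auto
  have ends_edges: "e \<in> ends G ` edges G \<longleftrightarrow> (\<exists>L\<in>set Ls. e \<in># steps L)" for e
  proof -
    have "e \<in> ends G ` edges G \<longleftrightarrow> e \<in># image_mset (ends G) (mset_set (edges G))"
      using assms(1) by simp
    then show ?thesis by (simp only: edges set_sum)
  qed
  have same: "L = L'" if "L \<in> set Ls" "L' \<in> set Ls" "u \<in> set L" "u \<in> set L'" for L L' u
    using assms(3) that by (auto simp: distinct_concat_iff dest: bspec)
  have class_eq: "connected_rel G `` {u} = set L" if "L \<in> set Ls" "u \<in> set L" for L u
  proof (intro equalityI subsetI)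
    fix v assume "v \<in> connected_rel G `` {u}"
    then have "(u, v) \<in> (adjacency G)\<^sup>*" by (simp add: connected_rel_def)
    then show "v \<in> set L"
    proof induction
      case (step x y)
      then have "{x, y} \<in> ends G ` edges G" by (auto simp: adjacency_def)
      then obtain L' where L': "L' \<in> set Ls" "{x, y} \<in># steps L'" using ends_edges by blast
      then have "x \<in> set L'" "y \<in> set L'" using steps_subset[of "{x, y}" L'] by auto
      then show ?case using same[OF that(1) L'(1)] step by auto
    qed (use that in simp)
  next
    fix v assume "v \<in> set L"
    moreover have "set_mset (steps L) \<subseteq> ends G ` edges G" using ends_edges that(1) by blast
    moreover have "set L \<subseteq> verts G" using that assms(4) by auto
    ultimately show "v \<in> connected_rel G `` {u}"
      using steps_connected[of L G u v] that(2) by (auto simp: connected_rel_def)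
  qed
  have quot: "verts G // connected_rel G = set ` set Ls"
  proof (intro equalityI subsetI)
    fix C assume "C \<in> verts G // connected_rel G"
    then obtain u where "u \<in> verts G" "C = connected_rel G `` {u}" by (rule quotientE)
    moreover then obtain L where "L \<in> set Ls" "u \<in> set L" using assms(4) by auto
    ultimately show "C \<in> set ` set Ls" using class_eq by auto
  next
    fix C assume "C \<in> set ` set Ls"
    then obtain L where L: "L \<in> set Ls" "C = set L" by auto
    then have "hd L \<in> set L" using assms(2) by (metis hd_in_set)
    moreover from this have "hd L \<in> verts G" using L(1) assms(4) by auto
    ultimately show "C \<in> verts G // connected_rel G"
      using class_eq[OF L(1)] L(2) by (metis quotientI)
  qed
  have filter_sum: "filter_mset P (\<Sum>L\<leftarrow>Ls. steps L) = (\<Sum>L\<leftarrow>Ls. filter_mset P (steps L))"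
    for P and Ls :: "'v list list"
    by (induction Ls) auto
  show "\<forall>C\<in>components G. is_path C"
  proof
    fix C assume "C \<in> components G"
    then obtain L where L: "L \<in> set Ls" "C = induced_subgraph G (set L)"
      unfolding components_def quot by auto
    have "image_mset (ends C) (mset_set (edges C))
        = filter_mset (\<lambda>e. e \<subseteq> set L) (image_mset (ends G) (mset_set (edges G)))"
      using assms(1) by (simp add: L(2) induced_subgraph_def filter_mset_image_mset
        filter_mset_mset_set)
    also have "\<dots> = (\<Sum>L'\<leftarrow>Ls. if L' = L then steps L else {#})"
      unfolding edges filter_sum
    proof (intro arg_cong[of _ _ sum_list] map_cong refl)
      fix L' assume L': "L' \<in> set Ls"
      show "filter_mset (\<lambda>e. e \<subseteq> set L) (steps L') = (if L' = L then steps L else {#})"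
      proof (cases "L' = L")
        case True
        then show ?thesis using steps_subset[of _ L] by (auto simp: filter_mset_eq_conv)
      next
        case False
        have "\<not> e \<subseteq> set L" if "e \<in># steps L'" for e
        proof
          assume "e \<subseteq> set L"
          moreover have "e \<noteq> {}" using that by (auto simp: steps_conv_nth)
          ultimately show False using steps_subset[OF that] same[OF L(1) L'] False by blast
        qed
        then show ?thesis using False by (auto simp: multiset_eq_iff count_eq_zero_iff)
      qed
    qed
    also have "\<dots> = steps L"
    proof -
      have "distinct Ls" using assms(2,3) by (auto simp: distinct_concat_iff)
      then show ?thesis using L(1) by (simp add: sum_list_distinct_conv_sum_set)
    qed
    finally have "image_mset (ends C) (mset_set (edges C)) = steps L" .
    moreover have "L \<noteq> []" "distinct L" using L(1) assms(2,3) by (auto simp: distinct_concat_iff)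
    moreover have "set L = verts C" "finite (edges C)"
      using assms(1) by (simp_all add: L(2) induced_subgraph_def)
    ultimately show "is_path C" unfolding is_path_iff by blast
  qed
  have "num_components G = card (verts G // connected_rel G)"
    unfolding num_components_def components_def
    by (rule card_image) (auto simp: inj_on_def induced_subgraph_def dest: arg_cong[of _ _ verts])
  also have "\<dots> = card (set Ls)"
    unfolding quot
  proof (rule card_image, rule inj_onI)
    fix L L' assume L: "L \<in> set Ls" "L' \<in> set Ls" "set L = set L'"
    then have "hd L \<in> set L" using assms(2) by (metis hd_in_set)
    then show "L = L'" using same[OF L(1,2)] L(3) by auto
  qed
  also have "\<dots> = length Ls" using assms(2,3)
    by (intro distinct_card) (auto simp: distinct_concat_iff)
  finally show "num_components G = length Ls" .
qed

section \<open>Edge counts in the complete multipartite multigraph\<close>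

lemma verts_K: "verts (K a n l m) = {..<n} \<times> {..<a}"
  by (auto simp: K_def Defs.part_def)

lemma ends_K: "ends (K a n l m) = fst"
  by (simp add: K_def)

lemma card_verts_K: "card (verts (K a n l m)) = n * a"
  by (simp add: verts_K card_cartesian_product)

lemma edges_K_cases:
  assumes "e \<in> edges (K a n l m)"
  obtains u v t where "e = ({u, v}, t)" "u \<noteq> v" "u \<in> verts (K a n l m)" "v \<in> verts (K a n l m)"
    "t < (if fst u = fst v then l else m)"
  using assms unfolding K_def multigraph.simps by blast

lemma finite_edges_K: "finite (edges (K a n l m))"
proof (rule finite_subset)
  show "edges (K a n l m) \<subseteq> Pow (verts (K a n l m)) \<times> {..<l + m}"
    by (auto elim!: edges_K_cases split: if_splits)
qed (simp add: verts_K)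

lemma edges_K_subgraph:
  assumes "p \<le> q"
  shows "edges (K a p l m) = {e \<in> edges (K a q l m). fst e \<subseteq> verts (K a p l m)}"
  using arg_cong[OF induced_subgraph_K[OF assms, of a l m], of edges]
  by (simp add: induced_subgraph_def K_def)

lemma card_multiplicity_K:
  assumes "u \<in> verts (K a n l m)" "v \<in> verts (K a n l m)" "u \<noteq> v"
  shows "card {e \<in> edges (K a n l m). fst e = {u, v}} = (if fst u = fst v then l else m)"
  using multiplicity_K[OF assms] by (simp add: ends_K)

lemma degree_K:
  assumes "v \<in> verts (K a n l m)"
  shows "(\<Sum>u\<in>verts (K a n l m) - {v}. if fst v = fst u then l else m)
       = l * (a - 1) + m * a * (n - 1)"
proof -
  define A where "A = {fst v} \<times> ({..<a} - {snd v})"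
  define B where "B = ({..<n} - {fst v}) \<times> {..<a}"
  have v: "fst v < n" "snd v < a" using assms by (auto simp: verts_K)
  have "verts (K a n l m) - {v} = A \<union> B" using v by (cases v) (auto simp: verts_K A_def B_def)
  moreover have "A \<inter> B = {}" "finite A" "finite B" by (auto simp: A_def B_def)
  ultimately have "(\<Sum>u\<in>verts (K a n l m) - {v}. if fst v = fst u then l else m)
      = (\<Sum>u\<in>A. if fst v = fst u then l else m) + (\<Sum>u\<in>B. if fst v = fst u then l else m)"
    by (simp add: sum.union_disjoint)
  also have "(\<Sum>u\<in>A. if fst v = fst u then l else m) = (\<Sum>u\<in>A. l)"
    by (intro sum.cong) (auto simp: A_def)
  also have "(\<Sum>u\<in>B. if fst v = fst u then l else m) = (\<Sum>u\<in>B. m)"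
    by (intro sum.cong) (auto simp: B_def)
  finally show ?thesis
    using v by (simp add: A_def B_def card_cartesian_product)
qed

lemma part_subset_verts_K: "i < n \<Longrightarrow> part a i \<subseteq> verts (K a n l m)"
  by (auto simp: verts_K Defs.part_def)

lemma edge_in_unique_part:
  assumes "e \<in> edges (K a n l m)" "fst e \<subseteq> part a i" "fst e \<subseteq> part a i'"
  shows "i = i'"
  using assms by (elim edges_K_cases) (auto simp: Defs.part_def)

lemma card_edges_in_part:
  assumes "i < n"
  shows "card {e \<in> edges (K a n l m). fst e \<subseteq> part a i} = (a choose 2) * l"
proof -
  have "{e \<in> edges (K a n l m). fst e \<subseteq> part a i} = {A. A \<subseteq> part a i \<and> card A = 2} \<times> {..<l}"
  proof (intro equalityI subsetI)
    fix e assume "e \<in> {e \<in> edges (K a n l m). fst e \<subseteq> part a i}"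
    then show "e \<in> {A. A \<subseteq> part a i \<and> card A = 2} \<times> {..<l}"
      by (auto elim!: edges_K_cases simp: Defs.part_def)
  next
    fix e assume "e \<in> {A. A \<subseteq> part a i \<and> card A = 2} \<times> {..<l}"
    then obtain u v t where e: "e = ({u, v}, t)" "u \<noteq> v" "{u, v} \<subseteq> part a i" "t < l"
      by (auto simp: card_2_iff)
    moreover have "fst u = fst v" using e(3) by (auto simp: Defs.part_def)
    moreover have "u \<in> verts (K a n l m)" "v \<in> verts (K a n l m)"
      using e(3) part_subset_verts_K[OF assms, of a l m] by auto
    ultimately show "e \<in> {e \<in> edges (K a n l m). fst e \<subseteq> part a i}"
      using mem_edges_K_iff[of u v t a n l m] by simp
  qed
  moreover have "card (part a i) = a" "finite (part a i)" by (simp_all add: Defs.part_def)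
  ultimately show ?thesis by (simp add: card_cartesian_product n_subsets)
qed

lemma sum_card_colors:
  assumes "finite E" "c \<in> E \<rightarrow> {1..k::nat}"
  shows "(\<Sum>j\<in>{1..k}. card {e \<in> E. c e = j \<and> P e}) = card {e \<in> E. P e}"
proof -
  have "{e \<in> E. P e} = (\<Union>j\<in>{1..k}. {e \<in> E. c e = j \<and> P e})" using assms(2) by fastforce
  also have "card \<dots> = (\<Sum>j\<in>{1..k}. card {e \<in> E. c e = j \<and> P e})"
    using assms(1) by (intro card_UN_disjoint) auto
  finally show ?thesis by simp
qed

lemma count_image_mset_set:
  "finite F \<Longrightarrow> count (image_mset f (mset_set F)) y = card {e \<in> F. f e = y}"
  by (simp add: count_image_mset Int_def vimage_def) (metis Collect_conj_eq Collect_mem_eq)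

lemma size_filter_image_mset_set:
  "finite F \<Longrightarrow> size (filter_mset P (image_mset f (mset_set F))) = card {e \<in> F. P (f e)}"
  by (simp add: filter_mset_image_mset)

section \<open>Necessity\<close>

lemma hamiltonian_cycle_iff:
  assumes "finite F" "F \<subseteq> edges H"
  shows "hamiltonian_cycle H F \<longleftrightarrow> (\<exists>xs. 2 \<le> length xs \<and> distinct xs \<and> set xs = verts H \<and>
    image_mset (ends H) (mset_set F) = closed_steps xs)"
  using assms by (simp add: hamiltonian_cycle_def is_cycle_iff spanning_subgraph_def)

text \<open>A proper nonempty part of a cycle consists of at least one path, and each path has one edge less
  than it has vertices.\<close>

lemma edges_inside_proper_subset:
  assumes "distinct xs" "S \<subset> set xs" "S \<noteq> {}"
  shows "size (filter_mset (\<lambda>e. e \<subseteq> S) (closed_steps xs)) \<le> card S - 1"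
proof -
  have "\<not> set xs \<subseteq> S" using assms by auto
  then obtain Ls where Ls: "[] \<notin> set Ls" "distinct (concat Ls)" "set (concat Ls) = set xs \<inter> S"
    "filter_mset (\<lambda>e. e \<subseteq> S) (closed_steps xs) = (\<Sum>L\<leftarrow>Ls. steps L)"
    using closed_steps_runs assms(1) by metis
  moreover have "set xs \<inter> S = S" using assms by auto
  moreover from this have "Ls \<noteq> []" using Ls(3) assms(3) by auto
  ultimately show ?thesis using size_filter_add_runs[OF Ls(1,2) Ls(4)] by (cases Ls) auto
qed

text \<open>Every Hamiltonian cycle uses two of the edges at a given vertex.\<close>

lemma hamiltonian_decomposition_degree:
  assumes "edge_coloring (K a n l m) k c" "v \<in> verts (K a n l m)"
    and "\<And>j. j \<in> {1..k} \<Longrightarrow> hamiltonian_cycle (K a n l m) (color_class (K a n l m) c j)"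
  shows "2 * k = l * (a - 1) + m * a * (n - 1)"
proof -
  let ?H = "K a n l m"
  have fin: "finite (color_class ?H c j)" for j using finite_edges_K by (simp add: color_class_def)
  have deg: "(\<Sum>u\<in>verts ?H - {v}. card {e \<in> edges ?H. c e = j \<and> fst e = {v, u}}) = 2"
    if j: "j \<in> {1..k}" for j
  proof -
    obtain xs where xs: "2 \<le> length xs" "distinct xs" "set xs = verts ?H"
      "image_mset fst (mset_set (color_class ?H c j)) = closed_steps xs"
      using assms(3)[OF j] hamiltonian_cycle_iff[of "color_class ?H c j" ?H] fin
      by (auto simp: color_class_def ends_K)
    have "degree_in (closed_steps xs) v = (\<Sum>u\<in>verts ?H - {v}. count (closed_steps xs) {v, u})"
    proof (rule degree_in_eq_sum_count)
      fix e assume e: "e \<in># closed_steps xs" "v \<in> e"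
      have "e \<subseteq> verts ?H" "card e = 2"
        using closed_steps_subset[OF e(1)] closed_steps_distinct_card[OF xs(2,1) e(1)] xs(3) by auto
      then show "\<exists>u\<in>verts ?H - {v}. e = {v, u}" using e(2) by (auto simp: card_2_iff)
    qed (auto simp: verts_K)
    moreover have "count (closed_steps xs) {v, u}
        = card {e \<in> edges ?H. c e = j \<and> fst e = {v, u}}" for u
      unfolding xs(4)[symmetric] count_image_mset_set[OF fin] by (simp add: color_class_def)
    ultimately show ?thesis using degree_in_closed_steps[OF xs(2,1)] assms(2) xs(3) by simp
  qed
  have "2 * k = (\<Sum>j\<in>{1..k}. \<Sum>u\<in>verts ?H - {v}. card {e \<in> edges ?H. c e = j \<and> fst e = {v, u}})"
    by (simp add: deg)
  also have "\<dots> = (\<Sum>u\<in>verts ?H - {v}. card {e \<in> edges ?H. fst e = {v, u}})"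
    using assms(1) unfolding edge_coloring_def
    by (subst sum.swap) (intro sum.cong refl sum_card_colors finite_edges_K)
  also have "\<dots> = (\<Sum>u\<in>verts ?H - {v}. if fst v = fst u then l else m)"
    using assms(2) by (intro sum.cong card_multiplicity_K) auto
  finally show ?thesis by (simp add: degree_K[OF assms(2)])
qed

text \<open>Each cycle has at most \<open>a - 1\<close> pure edges in a part, and the \<open>k\<close> cycles together use all
  \<open>l * a * (a - 1) / 2 = k * (a - 1)\<close> of them, so equality holds for every part and every color. The
  bound on the components follows by looking at the complement of \<open>G\<close>, where every
  cycle has at least \<open>r * (a - 1)\<close> edges on \<open>r * a\<close> vertices and hence at most \<open>r\<close> components.\<close>

lemma embedding_necessary:
  fixes a p r k \<mu> :: nat and c :: "(nat \<times> nat) set \<times> nat \<Rightarrow> nat"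
  defines "l \<equiv> \<mu> * a * (p + r - 1)"
  defines "G \<equiv> K a p l \<mu>" and "H \<equiv> K a (p + r) l \<mu>"
  assumes "a > 1" "p \<ge> 1" "r \<ge> 1"
    and "embeds_in_hamiltonian_decomposition G k c H"
  shows "2 * k = l * a"
    and "\<forall>j\<in>{1..k}. (\<forall>C\<in>components (color_subgraph G c j). is_path C) \<and>
      (\<forall>i<p. card (pure_edges a (color_subgraph G c j) i) = a - 1) \<and>
      card (mixed_edges (color_subgraph G c j)) \<le> p - 1 \<and>
      num_components (color_subgraph G c j) \<le> r"
proof -
  obtain c' where c': "edge_coloring H k c'" "\<And>e. e \<in> edges G \<Longrightarrow> c' e = c e"
    "\<And>j. j \<in> {1..k} \<Longrightarrow> hamiltonian_cycle H (color_class H c' j)"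
    using assms(7) unfolding embeds_in_hamiltonian_decomposition_def by blast
  have finH: "finite (edges H)" by (simp add: H_def finite_edges_K)
  have "(0, 0) \<in> verts H" using assms by (auto simp: H_def verts_K)
  then have "2 * k = l * (a - 1) + \<mu> * a * (p + r - 1)"
    using hamiltonian_decomposition_degree[of a "p + r" l \<mu> k c'] c' by (simp add: H_def)
  also have "\<dots> = l * (a - 1 + 1)" by (simp only: add_mult_distrib2 l_def mult_1_right)
  finally show k: "2 * k = l * a" using assms(4) by simp
  define cnt where "cnt j P = card {e \<in> edges H. c' e = j \<and> P (fst e)}" for j P
  have "\<exists>xs. 2 \<le> length xs \<and> distinct xs \<and> set xs = verts H \<and>
      image_mset fst (mset_set (color_class H c' j)) = closed_steps xs" if "j \<in> {1..k}" for j
    using c'(3)[OF that] hamiltonian_cycle_iff[of "color_class H c' j" H] finH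
    by (auto simp: color_class_def H_def ends_K)
  then obtain xs where xs: "\<And>j. j \<in> {1..k} \<Longrightarrow> 2 \<le> length (xs j)"
    "\<And>j. j \<in> {1..k} \<Longrightarrow> distinct (xs j)" "\<And>j. j \<in> {1..k} \<Longrightarrow> set (xs j) = verts H"
    "\<And>j. j \<in> {1..k} \<Longrightarrow> image_mset fst (mset_set (color_class H c' j)) = closed_steps (xs j)"
    by metis
  have cnt: "size (filter_mset P (closed_steps (xs j))) = cnt j P" if "j \<in> {1..k}" for j P
    unfolding xs(4)[OF that, symmetric] using finH
    by (subst size_filter_image_mset_set) (auto simp: color_class_def cnt_def)
  have pure_le: "cnt j (\<lambda>e. e \<subseteq> part a i) \<le> a - 1" if "j \<in> {1..k}" "i < p + r" for i j
  proof -
    have "part a i \<subset> set (xs j)"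
    proof
      show "part a i \<subseteq> set (xs j)"
        using part_subset_verts_K[OF that(2)] xs(3)[OF that(1)] by (simp add: H_def)
      have "((if i = 0 then 1 else 0), 0) \<in> verts H - part a i"
        using assms by (auto simp: H_def verts_K Defs.part_def)
      then show "part a i \<noteq> set (xs j)" using xs(3)[OF that(1)] by blast
    qed
    moreover have "part a i \<noteq> {}" "card (part a i) = a" using assms(4) by (auto simp: Defs.part_def)
    ultimately show ?thesis
      using edges_inside_proper_subset[OF xs(2)[OF that(1)]] cnt[OF that(1)] by metis
  qed
  have pure: "cnt j (\<lambda>e. e \<subseteq> part a i) = a - 1" if "j \<in> {1..k}" "i < p + r" for i j
  proof (rule ccontr)
    assume "cnt j (\<lambda>e. e \<subseteq> part a i) \<noteq> a - 1"
    then have "cnt j (\<lambda>e. e \<subseteq> part a i) < a - 1" using pure_le[OF that] by simp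
    then have "(\<Sum>j\<in>{1..k}. cnt j (\<lambda>e. e \<subseteq> part a i)) < (\<Sum>j\<in>{1..k}. a - 1)"
      using that pure_le by (intro sum_strict_mono_ex1) blast+
    moreover have "(\<Sum>j\<in>{1..k}. cnt j (\<lambda>e. e \<subseteq> part a i)) = (a choose 2) * l"
      using sum_card_colors[OF finH c'(1)[unfolded edge_coloring_def], of "\<lambda>e. fst e \<subseteq> part a i"]
        card_edges_in_part[OF that(2)] by (simp add: cnt_def H_def)
    ultimately have "2 * ((a choose 2) * l) < 2 * (k * (a - 1))" by simp
    also have "\<dots> = l * a * (a - 1)" by (simp add: k flip: mult.assoc)
    also have "\<dots> = 2 * ((a choose 2) * l)"
    proof -
      have "even (a * (a - 1))" by (cases a) auto
      then have "2 * (a choose 2) = a * (a - 1)" unfolding choose_two by (rule dvd_mult_div_cancel)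
      then show ?thesis by (metis mult.assoc mult.commute)
    qed
    finally show False by simp
  qed
  have VGH: "verts G \<subseteq> verts H" by (auto simp: G_def H_def verts_K)
  have edgesG: "edges G = {e \<in> edges H. fst e \<subseteq> verts G}"
    unfolding G_def H_def by (rule edges_K_subgraph) simp
  show "\<forall>j\<in>{1..k}. (\<forall>C\<in>components (color_subgraph G c j). is_path C) \<and>
      (\<forall>i<p. card (pure_edges a (color_subgraph G c j) i) = a - 1) \<and>
      card (mixed_edges (color_subgraph G c j)) \<le> p - 1 \<and>
      num_components (color_subgraph G c j) \<le> r"
  proof
    fix j assume j: "j \<in> {1..k}"
    let ?Gj = "color_subgraph G c j"
    have "edges ?Gj = {e \<in> edges G. c' e = j}"
      using c'(2) by (auto simp: color_subgraph_def spanning_subgraph_def color_class_def)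
    then have Gj: "verts ?Gj = verts G" "ends ?Gj = fst"
      "edges ?Gj = {e \<in> edges H. c' e = j \<and> fst e \<subseteq> verts G}"
      by (auto simp: color_subgraph_def spanning_subgraph_def edgesG)
        (simp_all add: G_def ends_K)
    have finGj: "finite (edges ?Gj)" using finH Gj(3) by simp
    have "(p, 0) \<in> verts H - verts G" using assms by (simp add: G_def H_def verts_K)
    then have proper: "verts G \<subset> set (xs j)" "\<not> set (xs j) \<subseteq> verts G"
      using VGH xs(3)[OF j] by auto
    obtain Ls where Ls: "[] \<notin> set Ls" "distinct (concat Ls)"
      "set (concat Ls) = set (xs j) \<inter> verts G"
      "filter_mset (\<lambda>e. e \<subseteq> verts G) (closed_steps (xs j)) = (\<Sum>L\<leftarrow>Ls. steps L)"
      using closed_steps_runs[OF proper(2) xs(2)[OF j]] .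
    have cover: "set (concat Ls) = verts ?Gj" using Ls(3) proper Gj(1) by auto
    have "image_mset (ends ?Gj) (mset_set (edges ?Gj)) = (\<Sum>L\<leftarrow>Ls. steps L)"
      unfolding Ls(4)[symmetric] xs(4)[OF j, symmetric] filter_mset_image_mset
      using finH by (simp add: Gj color_class_def)
    note forest = linear_forest_components[OF finGj Ls(1,2) cover this]
    have pure_edges: "pure_edges a ?Gj i = {e \<in> edges H. c' e = j \<and> fst e \<subseteq> part a i}"
      if "i < p" for i
      using part_subset_verts_K[OF that, of a l \<mu>] unfolding pure_edges_def Gj by (auto simp: G_def)
    have pure': "card (pure_edges a ?Gj i) = a - 1" if "i < p" for i
      using pure_edges[OF that] pure[OF j, of i] that by (simp add: cnt_def)
    \<comment> \<open>\<open>G\<close> is a proper part of every cycle, so that color \<open>j\<close> has at most \<open>p * a - 1\<close> edges there.\<close>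
    have "card (mixed_edges ?Gj) + p * (a - 1) \<le> p * a - 1"
    proof -
      have "p * (a - 1) = (\<Sum>i<p. card (pure_edges a ?Gj i))" by (simp add: pure')
      also have "\<dots> = card (\<Union>i<p. pure_edges a ?Gj i)"
      proof (rule card_UN_disjoint[symmetric])
        show "\<forall>i\<in>{..<p}. \<forall>i'\<in>{..<p}. i \<noteq> i' \<longrightarrow> pure_edges a ?Gj i \<inter> pure_edges a ?Gj i' = {}"
          using pure_edges edge_in_unique_part[of _ a "p + r" l \<mu>] unfolding H_def by blast
      qed (use finGj in \<open>auto simp: pure_edges_def\<close>)
      finally have "card (mixed_edges ?Gj) + p * (a - 1)
          = card (mixed_edges ?Gj \<union> (\<Union>i<p. pure_edges a ?Gj i))"
        using finGj by (subst card_Un_disjoint)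
          (auto simp: mixed_edges_def pure_edges_def Defs.part_def)
      also have "\<dots> \<le> card (edges ?Gj)"
        using finGj by (intro card_mono) (auto simp: mixed_edges_def pure_edges_def)
      also have "\<dots> = cnt j (\<lambda>e. e \<subseteq> verts G)" by (simp add: Gj cnt_def)
      also have "\<dots> \<le> card (verts G) - 1"
      proof -
        have "(0, 0) \<in> verts G" using assms by (simp add: G_def verts_K)
        then show ?thesis unfolding cnt[OF j, symmetric]
          by (intro edges_inside_proper_subset xs(2)[OF j] proper(1)) auto
      qed
      finally show ?thesis by (simp add: G_def card_verts_K)
    qed
    moreover have "p * a = p * (a - 1) + p" using assms(4) by (cases a) auto
    ultimately have mixed: "card (mixed_edges ?Gj) \<le> p - 1" by linarith
    have "length Ls \<le> r"
    proof -
      have "card (set (xs j) - verts G) = r * a"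
      proof -
        have fin: "finite (verts G)" by (simp add: G_def verts_K)
        show ?thesis unfolding xs(3)[OF j] card_Diff_subset[OF fin VGH]
          by (simp add: G_def H_def card_verts_K add_mult_distrib)
      qed
      moreover have "cnt j (\<lambda>e. e \<subseteq> verts G) + length Ls = card (verts G)"
        using size_filter_add_runs[OF Ls(1,2,4)] cnt[OF j] cover Gj(1) by simp
      moreover have "cnt j (\<lambda>e. e \<subseteq> verts G) + card (set (xs j) - verts G)
          = cnt j (\<lambda>e. e \<subseteq> set (xs j) - verts G) + card (verts G)"
        using edge_count_complement[OF xs(2,1)[OF j], of "verts G"] proper(1) cnt[OF j] by simp
      moreover have "r * (a - 1) \<le> cnt j (\<lambda>e. e \<subseteq> set (xs j) - verts G)"
      proof -
        have "r * (a - 1) = (\<Sum>i\<in>{p..<p + r}. cnt j (\<lambda>e. e \<subseteq> part a i))"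
          using pure[OF j] by simp
        also have "\<dots> = card (\<Union>i\<in>{p..<p + r}. {e \<in> edges H. c' e = j \<and> fst e \<subseteq> part a i})"
          unfolding cnt_def
        proof (rule card_UN_disjoint[symmetric])
          show "\<forall>i\<in>{p..<p + r}. \<forall>i'\<in>{p..<p + r}. i \<noteq> i' \<longrightarrow>
              {e \<in> edges H. c' e = j \<and> fst e \<subseteq> part a i}
                \<inter> {e \<in> edges H. c' e = j \<and> fst e \<subseteq> part a i'} = {}"
            using edge_in_unique_part[of _ a "p + r" l \<mu>] unfolding H_def by blast
        qed (use finH in auto)
        also have "\<dots> \<le> cnt j (\<lambda>e. e \<subseteq> set (xs j) - verts G)"
        proof -
          have "part a i \<subseteq> set (xs j) - verts G" if "i \<in> {p..<p + r}" for i
            using that unfolding xs(3)[OF j] by (auto simp: Defs.part_def G_def H_def verts_K)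
          then show ?thesis unfolding cnt_def using finH by (intro card_mono) (simp, blast)
        qed
        finally show ?thesis .
      qed
      moreover have "r * a = r * (a - 1) + r" using assms(4) by (cases a) auto
      ultimately show ?thesis by linarith
    qed
    then show "(\<forall>C\<in>components ?Gj. is_path C) \<and>
        (\<forall>i<p. card (pure_edges a ?Gj i) = a - 1) \<and>
        card (mixed_edges ?Gj) \<le> p - 1 \<and> num_components ?Gj \<le> r"
      using forest pure' mixed by simp
  qed
qed

section \<open>From a colored graph to ears\<close>

lemma sum_mset_set_disjoint:
  assumes "finite Q" "\<And>S. S \<in> Q \<Longrightarrow> finite (f S)"
    and "\<And>S T. S \<in> Q \<Longrightarrow> T \<in> Q \<Longrightarrow> S \<noteq> T \<Longrightarrow> f S \<inter> f T = {}"
  shows "(\<Sum>S\<in>Q. mset_set (f S)) = mset_set (\<Union>S\<in>Q. f S)"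
  using assms
proof (induction Q rule: finite_induct)
  case (insert S Q)
  have "f S \<inter> (\<Union>T\<in>Q. f T) = {}" using insert.prems(2) insert.hyps(2) by blast
  then show ?case using insert by (simp add: mset_set_Union)
qed simp

lemma count_steps_away_from_centre:
  assumes "w \<notin> e"
  shows "count (steps (w # L @ [w])) e = count (steps L) e"
proof (cases "L = []")
  case False
  show ?thesis unfolding steps_around[OF False] using assms by auto
qed (use assms in auto)

text \<open>The path components become ears at whatever vertex \<open>w\<close> outside \<open>G\<close> they are attached to, and empty
  ears pad their number to \<open>r\<close>.\<close>

lemma ears_of_linear_forest:
  assumes "loopless_multigraph G" "finite (verts G)" "finite (edges G)"
    and paths: "\<forall>C\<in>components G. is_path C" and "num_components G \<le> r"
  obtains E where "size E = r" "(\<Sum>L\<in>#E. mset L) = mset_set (verts G)"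
    "\<And>w u v. w \<notin> verts G \<Longrightarrow> u \<in> verts G \<Longrightarrow> v \<in> verts G \<Longrightarrow>
      count (walk_steps w E) {u, v} = card {e \<in> edges G. ends G e = {u, v}}"
proof -
  define Q where "Q = verts G // connected_rel G"
  let ?I = "induced_subgraph G"
  have eqv: "equiv (verts G) (connected_rel G)" by (rule equiv_connected_rel)
  have Q: "\<Union>Q = verts G" "\<And>S T. S \<in> Q \<Longrightarrow> T \<in> Q \<Longrightarrow> S \<noteq> T \<Longrightarrow> S \<inter> T = {}"
    using Union_quotient[OF eqv] quotient_disj[OF eqv] by (auto simp: Q_def)
  have finQ: "finite Q" unfolding Q_def quotient_def using assms(2) by simp
  have finS: "finite S" if "S \<in> Q" for S using that Q(1) assms(2) by (metis Sup_upper finite_subset)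
  have "\<forall>S\<in>Q. \<exists>L. distinct L \<and> set L = S \<and>
      image_mset (ends G) (mset_set {e \<in> edges G. ends G e \<subseteq> S}) = steps L"
  proof
    fix S assume "S \<in> Q"
    then have "is_path (?I S)" using paths by (auto simp: components_def Q_def)
    then show "\<exists>L. distinct L \<and> set L = S \<and>
        image_mset (ends G) (mset_set {e \<in> edges G. ends G e \<subseteq> S}) = steps L"
      unfolding is_path_iff by (auto simp: induced_subgraph_def)
  qed
  from bchoice[OF this] obtain P where P: "\<forall>S\<in>Q. distinct (P S) \<and> set (P S) = S \<and>
      image_mset (ends G) (mset_set {e \<in> edges G. ends G e \<subseteq> S}) = steps (P S)" ..
  define E where "E = image_mset P (mset_set Q) + replicate_mset (r - card Q) []"
  have sum_E: "(\<Sum>L\<in>#E. f L) = (\<Sum>S\<in>Q. f (P S))" if "f [] = {#}" for f :: "_ \<Rightarrow> 'x multiset"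
    using that by (simp add: E_def sum_unfold_sum_mset image_mset.compositionality comp_def)
  show thesis
  proof
    have "num_components G = card Q"
      unfolding num_components_def components_def Q_def
      by (rule card_image) (auto simp: inj_on_def induced_subgraph_def dest: arg_cong[of _ _ verts])
    then show "size E = r" using assms(5) by (simp add: E_def)
    have "(\<Sum>L\<in>#E. mset L) = (\<Sum>S\<in>Q. mset_set S)"
      unfolding sum_E[of mset, OF mset.simps(1)]
      using P by (intro sum.cong refl) (metis mset_set_set)
    also have "\<dots> = mset_set (\<Union>S\<in>Q. S)"
      using finQ finS Q(2) by (intro sum_mset_set_disjoint) auto
    finally show "(\<Sum>L\<in>#E. mset L) = mset_set (verts G)" using Q(1) by simp
    fix w u v assume "w \<notin> verts G" "u \<in> verts G" "v \<in> verts G"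
    then have w: "w \<notin> {u, v}" by auto
    have edges: "(\<Union>S\<in>Q. {e \<in> edges G. ends G e \<subseteq> S}) = edges G"
    proof (intro equalityI subsetI)
      fix e assume e: "e \<in> edges G"
      then obtain x y where xy: "ends G e = {x, y}" "{x, y} \<subseteq> verts G"
        using assms(1) unfolding loopless_multigraph_def by (metis card_2_iff)
      have "(x, y) \<in> adjacency G" using e xy(1) by (auto simp: adjacency_def)
      then have "{x, y} \<subseteq> connected_rel G `` {x}" using xy(2) by (auto simp: connected_rel_def)
      moreover have "connected_rel G `` {x} \<in> Q" using xy(2) by (auto simp: Q_def quotientI)
      ultimately show "e \<in> (\<Union>S\<in>Q. {e \<in> edges G. ends G e \<subseteq> S})" using e xy(1) by auto
    qed auto
    have "count (walk_steps w E) {u, v} = (\<Sum>L\<in>#E. count (steps L) {u, v})"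
      unfolding walk_steps_def count_sum_mset using count_steps_away_from_centre[OF w] by simp
    also have "\<dots> = count (\<Sum>L\<in>#E. steps L) {u, v}" by (simp add: count_sum_mset)
    also have "(\<Sum>L\<in>#E. steps L)
        = (\<Sum>S\<in>Q. image_mset (ends G) (mset_set {e \<in> edges G. ends G e \<subseteq> S}))"
      unfolding sum_E[of steps, OF steps.simps(2)] using P by simp
    also have "\<dots> = image_mset (ends G) (\<Sum>S\<in>Q. mset_set {e \<in> edges G. ends G e \<subseteq> S})"
      using finQ by (induction Q rule: finite_induct) auto
    also have "(\<Sum>S\<in>Q. mset_set {e \<in> edges G. ends G e \<subseteq> S})
        = mset_set (\<Union>S\<in>Q. {e \<in> edges G. ends G e \<subseteq> S})"
    proof (rule sum_mset_set_disjoint[OF finQ])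
      fix S T assume ST: "S \<in> Q" "T \<in> Q" "S \<noteq> T"
      have "ends G e \<noteq> {}" if "e \<in> edges G" for e
        using that assms(1) by (auto simp: loopless_multigraph_def)
      then show "{e \<in> edges G. ends G e \<subseteq> S} \<inter> {e \<in> edges G. ends G e \<subseteq> T} = {}"
        using Q(2)[OF ST] by blast
    qed (use assms(3) in auto)
    also note edges
    finally show "count (walk_steps w E) {u, v} = card {e \<in> edges G. ends G e = {u, v}}"
      using assms(3) by (simp add: count_image_mset_set)
  qed
qed

text \<open>In a bundle of ears every vertex other than \<open>w\<close> has degree 2, so the number of its edges to \<open>w\<close> is
  determined by its edges inside \<open>V\<close>.\<close>

lemma degree_in_walk_steps:
  assumes "(\<Sum>L\<in>#E. mset L) = mset_set V" "finite V" "w \<notin> V" "v \<in> V"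
  shows "count (walk_steps w E) {w, v} + (\<Sum>u\<in>V - {v}. count (walk_steps w E) {v, u}) = 2"
proof -
  have dist: "distinct L" "set L \<subseteq> V" if "L \<in># E" for L
  proof -
    obtain R where E: "E = add_mset L R" using \<open>L \<in># E\<close> multi_member_split by metis
    then have le: "mset L \<subseteq># mset_set V" using assms(1)[symmetric] by simp
    then have "set_mset (mset L) \<subseteq> set_mset (mset_set V)" by (rule set_mset_mono)
    then show "set L \<subseteq> V" using assms(2) by simp
    have "count (mset L) x = (if x \<in> set L then 1 else 0)" for x
    proof -
      have "count (mset L) x \<le> count (mset_set V) x" by (rule mset_subset_eq_count[OF le])
      also have "\<dots> \<le> 1" using assms(2) by (cases "x \<in> V") simp_all
      finally have le1: "count (mset L) x \<le> 1" .
      show ?thesis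
      proof (cases "x \<in> set L")
        case True
        then have "0 < count (mset L) x" by simp
        then have "count (mset L) x = 1" using le1 by linarith
        then show ?thesis using True by simp
      qed simp
    qed
    then show "distinct L" by (simp add: distinct_count_atmost_1)
  qed
  have mem: "e \<subseteq> insert w V \<and> (w \<notin> e \<or> e \<noteq> {w} \<longrightarrow> card e = 2)" if e: "e \<in># walk_steps w E" for e
  proof -
    obtain L where L: "L \<in># E" "e \<in># steps (w # L @ [w])"
      using e by (auto simp: walk_steps_def set_mset_sum_mset simp del: steps.simps)
    have "e \<subseteq> insert w V" using steps_subset[OF L(2)] dist[OF L(1)] by auto
    moreover have "card e = 2" if "e \<noteq> {w}"
    proof -
      have "L \<noteq> []" using L(2) that by auto
      then show ?thesis using closed_steps_distinct_card[of "w # L" e] L dist[OF L(1)] assms(3)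
        by (cases L) (auto simp: closed_steps_Cons)
    qed
    ultimately show ?thesis by blast
  qed
  have "degree_in (walk_steps w E) v = (\<Sum>u\<in>insert w (V - {v}). count (walk_steps w E) {v, u})"
  proof (rule degree_in_eq_sum_count)
    show "v \<notin> insert w (V - {v})" using assms(3,4) by auto
    fix e assume e: "e \<in># walk_steps w E" "v \<in> e"
    have "e \<noteq> {w}" using e(2) assms(3,4) by auto
    then have "e \<subseteq> insert w V" "card e = 2" using mem[OF e(1)] by auto
    then show "\<exists>u\<in>insert w (V - {v}). e = {v, u}" using e(2) by (auto simp: card_2_iff)
  qed (use assms(2) in auto)
  moreover have "degree_in (walk_steps w E) v = 2"
  proof -
    have "degree_in (walk_steps w E) v = (\<Sum>L\<in>#E. degree_in (steps (w # L @ [w])) v)"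
      by (induction E) simp_all
    also have "\<dots> = (\<Sum>L\<in>#E. 2 * count (mset L) v)"
      using dist assms(3,4) by (intro arg_cong[of _ _ sum_mset] image_mset_cong degree_in_around) auto
    also have "\<dots> = 2 * count (\<Sum>L\<in>#E. mset L) v"
      by (simp add: count_sum_mset sum_mset_distrib_left)
    finally show ?thesis using assms by simp
  qed
  ultimately show ?thesis using assms(2,3) by (simp add: insert_commute)
qed

lemma size_eq_sum_count: "finite A \<Longrightarrow> set_mset M \<subseteq> A \<Longrightarrow> size M = (\<Sum>x\<in>A. count M x)"
  unfolding size_multiset_overloaded_eq
  by (rule sum.mono_neutral_left) (auto simp: count_eq_zero_iff)

text \<open>Counting the half-edges at \<open>w\<close>, two for each ear.\<close>

lemma count_ends_walk_steps:
  assumes "\<And>L. L \<in># E \<Longrightarrow> set L \<subseteq> V" "finite V" "w \<notin> V"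
  shows "(\<Sum>v\<in>V. count (walk_steps w E) {w, v}) + 2 * count (walk_steps w E) {w} = 2 * size E"
proof -
  have w: "w \<notin> set L" if "L \<in># E" for L using assms(1)[OF that] assms(3) by auto
  have "(\<Sum>v\<in>V. count (walk_steps w E) {w, v}) + 2 * count (walk_steps w E) {w}
      = (\<Sum>v\<in>insert w V. \<Sum>L\<in>#E. count (ear_ends w L) v)"
  proof -
    have "(\<Sum>v\<in>V. count (walk_steps w E) {w, v}) = (\<Sum>v\<in>V. \<Sum>L\<in>#E. count (ear_ends w L) v)"
      using assms(3) w by (intro sum.cong refl count_walk_steps) auto
    then show ?thesis using assms(2,3) w by (simp add: count_walk_steps)
  qed
  also have "\<dots> = (\<Sum>L\<in>#E. \<Sum>v\<in>insert w V. count (ear_ends w L) v)"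
    by (induction E) (simp_all add: sum.distrib)
  also have "\<dots> = (\<Sum>L\<in>#E. 2)"
  proof (intro arg_cong[of _ _ sum_mset] image_mset_cong)
    fix L assume "L \<in># E"
    then have "set L \<subseteq> V" using assms(1) by simp
    then have "set_mset (ear_ends w L) \<subseteq> insert w V"
      by (cases "L = []") (auto simp: ear_ends_def subsetD)
    then have "(\<Sum>v\<in>insert w V. count (ear_ends w L) v) = size (ear_ends w L)"
      using size_eq_sum_count[of "insert w V" "ear_ends w L"] assms(2) by simp
    then show "(\<Sum>v\<in>insert w V. count (ear_ends w L) v) = 2" by (simp add: ear_ends_def)
  qed
  finally show ?thesis by (simp add: mult.commute)
qed

section \<open>Coloring the new edges\<close>

lemma function_with_fibre_cards:
  fixes q :: "'j \<Rightarrow> nat"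
  assumes "finite J"
  shows "\<exists>f. (\<forall>t<sum q J. f t \<in> J) \<and> (\<forall>j\<in>J. card {t. t < sum q J \<and> f t = j} = q j)"
proof -
  obtain ls where ls: "mset ls = (\<Sum>j\<in>J. replicate_mset (q j) j)" using ex_mset by blast
  have "length ls = sum q J"
  proof -
    have "size (\<Sum>j\<in>J. replicate_mset (q j) j) = sum q J" using assms by (induction J) auto
    then show ?thesis by (simp flip: ls)
  qed
  moreover have cnt: "count (mset ls) i = (if i \<in> J then q i else 0)" for i
    unfolding ls using assms by (induction J) auto
  moreover have "count (mset ls) j = card {t. t < length ls \<and> ls ! t = j}" for j
    by (simp add: count_mset count_list_eq_length_filter length_filter_conv_card eq_commute)
  moreover have "ls ! t \<in> J" if "t < length ls" for t
    using cnt[of "ls ! t"] that by (metis count_eq_zero_iff nth_mem set_mset_mset)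
  ultimately show ?thesis by (intro exI[of _ "\<lambda>t. ls ! t"]) simp
qed

text \<open>Once every color \<open>j\<close> is given as a multiset \<open>D j\<close> of end sets and the totals agree with the
  multiplicities, the parallel edges between two vertices can be colored arbitrarily subject to
  the prescribed numbers. The edges of the smaller graph keep their colors, whose numbers are
  already correct.\<close>

lemma extend_coloring:
  assumes "p \<le> n" "edge_coloring (K a p l m) k c"
    and old: "\<And>j u v. j \<in> {1..k} \<Longrightarrow> u \<in> verts (K a p l m) \<Longrightarrow> v \<in> verts (K a p l m) \<Longrightarrow>
      count (D j) {u, v} = card {e \<in> edges (K a p l m). c e = j \<and> fst e = {u, v}}"
    and total: "\<And>u v. u \<in> verts (K a n l m) \<Longrightarrow> v \<in> verts (K a n l m) \<Longrightarrow> u \<noteq> v \<Longrightarrow>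
      (\<Sum>j\<in>{1..k}. count (D j) {u, v}) = (if fst u = fst v then l else m)"
    and D: "\<And>j e. j \<in> {1..k} \<Longrightarrow> e \<in># D j \<Longrightarrow> e \<subseteq> verts (K a n l m) \<and> card e = 2"
  shows "\<exists>c'. edge_coloring (K a n l m) k c' \<and> (\<forall>e\<in>edges (K a p l m). c' e = c e) \<and>
    (\<forall>j\<in>{1..k}. image_mset fst (mset_set (color_class (K a n l m) c' j)) = D j)"
proof -
  let ?G = "K a p l m" and ?H = "K a n l m" and ?N = "\<lambda>A. \<Sum>j\<in>{1..k}. count (D j) A"
  have "\<forall>A. \<exists>f. (\<forall>t<?N A. f t \<in> {1..k}) \<and>
      (\<forall>j\<in>{1..k}. card {t. t < ?N A \<and> f t = j} = count (D j) A)"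
    by (intro allI function_with_fibre_cards) simp
  from choice[OF this] obtain f where "\<forall>A. (\<forall>t<?N A. f A t \<in> {1..k}) \<and>
      (\<forall>j\<in>{1..k}. card {t. t < ?N A \<and> f A t = j} = count (D j) A)" ..
  then have f: "\<And>A t. t < ?N A \<Longrightarrow> f A t \<in> {1..k}"
    "\<And>A j. j \<in> {1..k} \<Longrightarrow> card {t. t < ?N A \<and> f A t = j} = count (D j) A" by blast+
  define c' where "c' e = (if fst e \<subseteq> verts ?G then c e else f (fst e) (snd e))" for e
  have edgesG: "edges ?G = {e \<in> edges ?H. fst e \<subseteq> verts ?G}"
    by (rule edges_K_subgraph[OF assms(1)])
  have new: "(A, t) \<in> edges ?H \<longleftrightarrow> t < ?N A"
    if A: "A = {u, v}" "u \<in> verts ?H" "v \<in> verts ?H" "u \<noteq> v" for A t u v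
    using mem_edges_K_iff[OF A(4), of t a n l m] total[OF A(2-4)] A by simp
  show ?thesis
  proof (intro exI conjI ballI)
    show "edge_coloring ?H k c'"
      unfolding edge_coloring_def
    proof
      fix e assume e: "e \<in> edges ?H"
      then obtain u v t where uv: "e = ({u, v}, t)" "u \<noteq> v" "u \<in> verts ?H" "v \<in> verts ?H"
        by (elim edges_K_cases) blast
      show "c' e \<in> {1..k}"
      proof (cases "fst e \<subseteq> verts ?G")
        case True
        then have "e \<in> edges ?G" using e edgesG by blast
        then have "c e \<in> {1..k}" using assms(2) unfolding edge_coloring_def by blast
        then show ?thesis using True by (simp add: c'_def)
      next
        case False
        have "t < ?N {u, v}" using new[OF refl uv(3,4,2), of t] e uv(1) by simp
        moreover have "c' e = f {u, v} t" using False uv(1) by (auto simp: c'_def)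
        ultimately show ?thesis using f(1) by metis
      qed
    qed
    show "c' e = c e" if "e \<in> edges ?G" for e using that edgesG by (simp add: c'_def)
    fix j assume j: "j \<in> {1..k}"
    show "image_mset fst (mset_set (color_class ?H c' j)) = D j"
    proof (rule multiset_eqI)
      fix A
      have "card {e \<in> edges ?H. c' e = j \<and> fst e = A} = count (D j) A"
      proof (cases "A \<subseteq> verts ?H \<and> card A = 2")
        case False
        then have "A \<notin># D j" using D[OF j] by blast
        moreover have "{e \<in> edges ?H. c' e = j \<and> fst e = A} = {}"
          using False loopless_multigraph_K[of a n l m] unfolding loopless_multigraph_def ends_K
          by blast
        ultimately show ?thesis by (simp only: card.empty count_eq_zero_iff[symmetric])
      next
        case True
        then obtain u v where uv: "A = {u, v}" "u \<noteq> v" "u \<in> verts ?H" "v \<in> verts ?H"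
          by (auto simp: card_2_iff)
        show ?thesis
        proof (cases "A \<subseteq> verts ?G")
          case AG: True
          have "{e \<in> edges ?H. c' e = j \<and> fst e = A} = {e \<in> edges ?G. c e = j \<and> fst e = A}"
            using AG by (auto simp: edgesG c'_def)
          then show ?thesis using old[OF j, of u v] AG uv(1) by simp
        next
          case AG: False
          have "{e \<in> edges ?H. c' e = j \<and> fst e = A} = Pair A ` {t. t < ?N A \<and> f A t = j}"
          proof (rule set_eqI)
            fix e :: "(nat \<times> nat) set \<times> nat"
            obtain B t where e: "e = (B, t)" by (cases e)
            show "e \<in> {e \<in> edges ?H. c' e = j \<and> fst e = A}
                \<longleftrightarrow> e \<in> Pair A ` {t. t < ?N A \<and> f A t = j}"
            proof (cases "B = A")
              case True
              have "e \<in> edges ?H \<longleftrightarrow> t < ?N A" using new[OF uv(1,3,4,2), of t] e True by simp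
              moreover have "c' e = f A t" using AG e True by (simp add: c'_def)
              moreover have "e \<in> Pair A ` {t. t < ?N A \<and> f A t = j} \<longleftrightarrow> t < ?N A \<and> f A t = j"
                using e True by auto
              moreover have "fst e = A" using e True by simp
              ultimately show ?thesis by (simp only: mem_Collect_eq simp_thms)
            qed (use e in auto)
          qed
          then show ?thesis using f(2)[OF j, of A] by (simp add: card_image inj_on_def)
        qed
      qed
      then show "count (image_mset fst (mset_set (color_class ?H c' j))) A = count (D j) A"
        using finite_edges_K[of a n l m] by (simp add: count_image_mset_set color_class_def)
    qed
  qed
qed

section \<open>Sufficiency\<close>

text \<open>The vertices of the graph in which the parts from \<open>t\<close> on are still amalgamated, part \<open>i\<close> being
  represented by its first vertex \<open>(i, 0)\<close>.\<close>

definition partly_split_verts :: "nat \<Rightarrow> nat \<Rightarrow> nat \<Rightarrow> (nat \<times> nat) set" where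
  "partly_split_verts a n t = {v \<in> {..<n} \<times> {..<a}. t \<le> fst v \<longrightarrow> snd v = 0}"

text \<open>The number of vertices of the final graph for which a vertex stands.\<close>

definition weight :: "nat \<Rightarrow> nat \<Rightarrow> nat \<times> nat \<Rightarrow> nat" where
  "weight a t v = (if t \<le> fst v then a else 1)"

text \<open>Each of the \<open>k\<close> cycles visits every vertex of the partly amalgamated graph once, and together they
  have the edges of the amalgamation of \<open>K a n l m\<close>, except for the pure edges of the parts that are
  not yet split. Those would be loops, and every cycle will receive \<open>a - 1\<close> of them when its turn
  comes to pass through the split part.\<close>

definition partly_split_decomposition ::
  "nat \<Rightarrow> nat \<Rightarrow> nat \<Rightarrow> nat \<Rightarrow> nat \<Rightarrow> nat \<Rightarrow> (nat \<Rightarrow> (nat \<times> nat) list) \<Rightarrow> bool" where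
  "partly_split_decomposition a n l m k t C \<longleftrightarrow>
    (\<forall>j\<in>{1..k}. mset (C j) = mset_set (partly_split_verts a n t)) \<and>
    (\<forall>u\<in>partly_split_verts a n t. \<forall>v\<in>partly_split_verts a n t. u \<noteq> v \<longrightarrow>
      (\<Sum>j\<in>{1..k}. count (closed_steps (C j)) {u, v})
        = (if fst u = fst v then l else m * weight a t u * weight a t v))"

lemma mset_eq_mset_setD:
  assumes "mset xs = mset_set A" "finite A"
  shows "distinct xs" "set xs = A"
proof -
  obtain ys where ys: "set ys = A" "distinct ys" using assms(2) finite_distinct_list by blast
  then have "mset xs = mset ys" using assms(1) mset_set_set by metis
  then show "distinct xs" "set xs = A" using ys mset_eq_imp_distinct_iff mset_eq_setD by metis+
qed

text \<open>Give each cycle \<open>a - 1\<close> empty ears at the vertex \<open>w\<close> representing part \<open>t\<close>; these are the \<open>a - 1\<close> pure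
  edges that it has to use there. By \<open>2 * k = l * a\<close> their total number \<open>k * (a - 1)\<close> is that of the
  pure edges of the part, so detaching \<open>w\<close> into \<open>a\<close> vertices yields \<open>l\<close> edges between any two of
  them.\<close>

lemma split_next_part:
  assumes "t < n" "1 < a" "1 \<le> t" "2 * k = l * a"
    and C: "partly_split_decomposition a n l m k t C"
  shows "\<exists>C'. partly_split_decomposition a n l m k (Suc t) C' \<and>
    (\<forall>j\<in>{1..k}. \<forall>u\<in>{..<t} \<times> {..<a}. \<forall>v\<in>{..<t} \<times> {..<a}.
      count (closed_steps (C' j)) {u, v} = count (closed_steps (C j)) {u, v})"
proof -
  let ?J = "{1..k}"
  have C: "\<And>j. j \<in> ?J \<Longrightarrow> mset (C j) = mset_set (partly_split_verts a n t)"
    and total: "\<And>u v. u \<in> partly_split_verts a n t \<Longrightarrow> v \<in> partly_split_verts a n t \<Longrightarrow> u \<noteq> v \<Longrightarrow>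
      (\<Sum>j\<in>?J. count (closed_steps (C j)) {u, v})
        = (if fst u = fst v then l else m * weight a t u * weight a t v)"
    using C unfolding partly_split_decomposition_def by blast+
  define w where "w = (t, 0::nat)"
  define V where "V = partly_split_verts a n t - {w}"
  define Z where "Z = {t} \<times> {1..<a}"
  have fin: "finite (partly_split_verts a n t)" by (simp add: partly_split_verts_def)
  have w: "w \<in> partly_split_verts a n t" using assms by (simp add: w_def partly_split_verts_def)
  have VZ: "partly_split_verts a n (Suc t) = insert w (V \<union> Z)"
    using assms by (auto simp: partly_split_verts_def V_def Z_def w_def)
  have fstV: "fst v \<noteq> t" if "v \<in> V" for v
    using that by (cases v) (auto simp: V_def partly_split_verts_def w_def)
  have fstZ: "fst z = t" if "z \<in> insert w Z" for z using that by (auto simp: Z_def w_def)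
  have "\<exists>L. mset (C j) = mset (w # L) \<and> closed_steps (C j) = steps (w # L @ [w])" if "j \<in> ?J" for j
  proof -
    have "set_mset (mset (C j)) = partly_split_verts a n t" using C[OF that] fin by simp
    then have "w \<in> set (C j)" using w by simp
    then show ?thesis using closed_steps_rotate by metis
  qed
  then obtain L where L: "\<And>j. j \<in> ?J \<Longrightarrow> mset (C j) = mset (w # L j)"
    "\<And>j. j \<in> ?J \<Longrightarrow> closed_steps (C j) = steps (w # L j @ [w])" by metis
  have msetL: "mset (L j) = mset_set V" if "j \<in> ?J" for j
    using C[OF that] L(1)[OF that] fin w by (simp add: V_def mset_set.remove)
  define E where "E j = add_mset (L j) (replicate_mset (a - 1) [])" for j
  have walk: "walk_steps w (E j) = closed_steps (C j) + replicate_mset (a - 1) {w}" if "j \<in> ?J" for j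
  proof -
    have "walk_steps w (replicate_mset i []) = replicate_mset i {w}" for i
      by (induction i) simp_all
    then show ?thesis using L(2)[OF that] by (simp add: E_def del: steps.simps)
  qed
  \<comment> \<open>Only the empty ears are loops, because a cycle of length at least 2 has none.\<close>
  have no_loop: "count (closed_steps (C j)) {w} = 0" if "j \<in> ?J" for j
  proof -
    have "finite V" using fin by (simp add: V_def)
    note Lj = mset_eq_mset_setD[OF msetL[OF that] this]
    have "(0, 0) \<in> V" using assms by (auto simp: V_def partly_split_verts_def w_def)
    then have "L j \<noteq> []" using Lj(2) by auto
    then have "2 \<le> length (w # L j)" by (cases "L j") auto
    moreover have "distinct (w # L j)" using Lj by (simp add: V_def)
    ultimately have "\<forall>e\<in>#closed_steps (w # L j). card e = 2"
      using closed_steps_distinct_card by blast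
    then have "{w} \<notin># closed_steps (C j)" using L(2)[OF that] by (force simp: closed_steps_Cons)
    then show ?thesis by (simp add: count_eq_zero_iff)
  qed
  have "\<exists>L'. (\<forall>j\<in>?J. mset (L' j) = mset_set (V \<union> Z) \<and>
        (\<forall>u\<in>V. \<forall>v\<in>V. count (steps (w # L' j @ [w])) {u, v} = count (walk_steps w (E j)) {u, v})) \<and>
      (\<forall>z\<in>insert w Z. \<forall>v\<in>V. (\<Sum>j\<in>?J. count (steps (w # L' j @ [w])) {z, v}) = m * weight a t v) \<and>
      (\<forall>z\<in>insert w Z. \<forall>z'\<in>insert w Z. z \<noteq> z' \<longrightarrow>
        (\<Sum>j\<in>?J. count (steps (w # L' j @ [w])) {z, z'}) = l)"
  proof (rule detachment)
    show "size (E j) = a" for j using assms(2) by (simp add: E_def)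
    show "(\<Sum>L\<in>#E j. mset L) = mset_set V" if "j \<in> ?J" for j
      using msetL[OF that] by (simp add: E_def)
    show "finite V" "w \<notin> V" using fin by (auto simp: V_def)
    show "(\<Sum>j\<in>?J. count (walk_steps w (E j)) {w, v}) = a * (m * weight a t v)" if v: "v \<in> V" for v
    proof -
      have "w \<noteq> v" using v by (auto simp: V_def)
      then have "(\<Sum>j\<in>?J. count (walk_steps w (E j)) {w, v}) = (\<Sum>j\<in>?J. count (closed_steps (C j)) {w, v})"
        by (intro sum.cong refl) (auto simp: walk count_replicate_mset)
      also have "\<dots> = m * weight a t w * weight a t v"
        using total[OF w, of v] v fstV[OF v] by (auto simp: V_def w_def)
      finally show ?thesis by (simp add: weight_def w_def)
    qed
    have "2 * (\<Sum>j\<in>?J. count (walk_steps w (E j)) {w}) = 2 * (\<Sum>j\<in>?J. a - 1)"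
      by (intro arg_cong[of _ _ "(*) 2"] sum.cong refl) (simp add: walk no_loop)
    also have "\<dots> = (2 * k) * (a - 1)" by simp
    finally show "2 * (\<Sum>j\<in>?J. count (walk_steps w (E j)) {w}) = l * a * (a - 1)"
      by (simp only: assms(4))
    have "z \<noteq> w \<and> z \<notin> V" if "z \<in> Z" for z using that fstV[of z] by (auto simp: Z_def w_def)
    then show "Z \<inter> insert w V = {}" by blast
  qed (use assms(2) in \<open>auto simp: Z_def card_cartesian_product\<close>)
  then obtain L' where
    L12: "\<forall>j\<in>?J. mset (L' j) = mset_set (V \<union> Z) \<and>
        (\<forall>u\<in>V. \<forall>v\<in>V. count (steps (w # L' j @ [w])) {u, v} = count (walk_steps w (E j)) {u, v})"
    and L3: "\<forall>z\<in>insert w Z. \<forall>v\<in>V.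
      (\<Sum>j\<in>?J. count (steps (w # L' j @ [w])) {z, v}) = m * weight a t v"
    and L4: "\<forall>z\<in>insert w Z. \<forall>z'\<in>insert w Z. z \<noteq> z' \<longrightarrow>
        (\<Sum>j\<in>?J. count (steps (w # L' j @ [w])) {z, z'}) = l"
    by (elim exE conjE) (rule that)
  define C' where "C' j = w # L' j" for j
  have steps_C': "steps (w # L' j @ [w]) = closed_steps (C' j)" for j
    by (simp add: C'_def closed_steps_Cons)
  have keep: "count (closed_steps (C' j)) {u, v} = count (closed_steps (C j)) {u, v}"
    if "j \<in> ?J" "u \<in> V" "v \<in> V" for j u v
  proof -
    have "u \<noteq> w" using that by (auto simp: V_def)
    moreover have "count (closed_steps (C' j)) {u, v} = count (walk_steps w (E j)) {u, v}"
      using L12 that unfolding steps_C' by blast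
    ultimately show ?thesis using walk[OF that(1)] by simp
  qed
  have wt: "weight a (Suc t) v = weight a t v" if "v \<in> V" for v
    using fstV[OF that] by (auto simp: weight_def)
  have wt1: "weight a (Suc t) z = 1" if "z \<in> insert w Z" for z
    using fstZ[OF that] by (simp add: weight_def)
  have cross: "(\<Sum>j\<in>?J. count (closed_steps (C' j)) {z, v})
      = m * weight a (Suc t) z * weight a (Suc t) v" if "z \<in> insert w Z" "v \<in> V" for z v
    using bspec[OF bspec[OF L3 that(1)] that(2)]
    unfolding steps_C' wt[OF that(2)] wt1[OF that(1)] by simp
  show ?thesis
    unfolding partly_split_decomposition_def
  proof (intro exI[of _ C'] conjI ballI allI impI)
    fix j assume j: "j \<in> ?J"
    have "w \<notin> V \<union> Z" "finite (V \<union> Z)" using fin by (auto simp: V_def Z_def w_def)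
    then show "mset (C' j) = mset_set (partly_split_verts a n (Suc t))"
      using L12 j unfolding VZ C'_def by simp
  next
    fix u v assume "u \<in> partly_split_verts a n (Suc t)" "v \<in> partly_split_verts a n (Suc t)"
    then have "u \<in> V \<or> u \<in> insert w Z" "v \<in> V \<or> v \<in> insert w Z" unfolding VZ by auto
    moreover assume "u \<noteq> v"
    ultimately consider "u \<in> V" "v \<in> V" | "u \<in> V" "v \<in> insert w Z" | "u \<in> insert w Z" "v \<in> V"
      | "u \<in> insert w Z" "v \<in> insert w Z" by blast
    then show "(\<Sum>j\<in>?J. count (closed_steps (C' j)) {u, v})
        = (if fst u = fst v then l else m * weight a (Suc t) u * weight a (Suc t) v)"
    proof cases
      case 1
      then have "(\<Sum>j\<in>?J. count (closed_steps (C' j)) {u, v})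
          = (\<Sum>j\<in>?J. count (closed_steps (C j)) {u, v})"
        by (intro sum.cong refl keep)
      then show ?thesis using total[of u v] 1 \<open>u \<noteq> v\<close> wt by (simp add: V_def)
    next
      case 2
      then show ?thesis using cross[of v u] fstV[of u] fstZ[of v] by (simp add: insert_commute mult_ac)
    next
      case 3
      then show ?thesis using cross[of u v] fstV[of v] fstZ[of u] by simp
    next
      case 4
      have "fst u = fst v" using fstZ[OF 4(1)] fstZ[OF 4(2)] by simp
      then show ?thesis using mp[OF bspec[OF bspec[OF L4 4(1)] 4(2)] \<open>u \<noteq> v\<close>]
        unfolding steps_C' by simp
    qed
  next
    fix j u v assume "j \<in> ?J" "u \<in> {..<t} \<times> {..<a}" "v \<in> {..<t} \<times> {..<a}"
    then show "count (closed_steps (C' j)) {u, v} = count (closed_steps (C j)) {u, v}"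
      using assms(1) by (intro keep) (auto simp: V_def w_def partly_split_verts_def)
  qed
qed

lemma split_all_parts:
  assumes "p \<le> n" "1 < a" "1 \<le> p" "2 * k = l * a"
    and C: "partly_split_decomposition a n l m k p C"
  shows "\<exists>C'. partly_split_decomposition a n l m k n C' \<and>
    (\<forall>j\<in>{1..k}. \<forall>u\<in>{..<p} \<times> {..<a}. \<forall>v\<in>{..<p} \<times> {..<a}.
      count (closed_steps (C' j)) {u, v} = count (closed_steps (C j)) {u, v})"
proof -
  have "t \<le> n \<Longrightarrow> \<exists>C'. partly_split_decomposition a n l m k t C' \<and>
    (\<forall>j\<in>{1..k}. \<forall>u\<in>{..<p} \<times> {..<a}. \<forall>v\<in>{..<p} \<times> {..<a}.
      count (closed_steps (C' j)) {u, v} = count (closed_steps (C j)) {u, v})" if "p \<le> t" for t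
    using that
  proof (induction t rule: dec_induct)
    case base
    then show ?case using C by blast
  next
    case (step t)
    obtain C\<^sub>1 where C\<^sub>1: "partly_split_decomposition a n l m k t C\<^sub>1"
      "\<forall>j\<in>{1..k}. \<forall>u\<in>{..<p} \<times> {..<a}. \<forall>v\<in>{..<p} \<times> {..<a}.
        count (closed_steps (C\<^sub>1 j)) {u, v} = count (closed_steps (C j)) {u, v}"
      using step.IH step.prems Suc_leD by blast
    have t: "t < n" "1 \<le> t" using step.prems step.hyps assms(3) by auto
    obtain C\<^sub>2 where C\<^sub>2: "partly_split_decomposition a n l m k (Suc t) C\<^sub>2"
      "\<forall>j\<in>{1..k}. \<forall>u\<in>{..<t} \<times> {..<a}. \<forall>v\<in>{..<t} \<times> {..<a}.
        count (closed_steps (C\<^sub>2 j)) {u, v} = count (closed_steps (C\<^sub>1 j)) {u, v}"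
      using split_next_part[OF t(1) assms(2) t(2) assms(4) C\<^sub>1(1)] by blast
    have sub: "{..<p} \<times> {..<a} \<subseteq> {..<t} \<times> {..<a}" using step.hyps by auto
    show ?case
    proof (intro exI[of _ C\<^sub>2] conjI ballI C\<^sub>2(1))
      fix j u v assume juv: "j \<in> {1..k}" "u \<in> {..<p} \<times> {..<a}" "v \<in> {..<p} \<times> {..<a}"
      then show "count (closed_steps (C\<^sub>2 j)) {u, v} = count (closed_steps (C j)) {u, v}"
        using bspec[OF bspec[OF bspec[OF C\<^sub>2(2) juv(1)]] subsetD[OF sub juv(3)], of u] sub
          bspec[OF bspec[OF bspec[OF C\<^sub>1(2) juv(1)] juv(2)] juv(3)] by auto
    qed
  qed
  then show ?thesis using assms(1) by blast
qed

text \<open>First stage of the construction: all new vertices are amalgamated into one vertex \<open>w\<close>, which is then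
  detached into \<open>r\<close> vertices, one for each new part. The numbers required by the detachment
  theorem follow from the degrees: a vertex of \<open>G\<close> needs \<open>2 * k\<close> half-edges in all colors and
  has all but \<open>r * (\<mu> * a)\<close> of them in \<open>G\<close>; each of the \<open>r * k\<close> ears has two ends, and those not used
  by the vertices of \<open>G\<close> form the loops.\<close>

lemma amalgamated_decomposition:
  fixes a p r k \<mu> :: nat and c :: "(nat \<times> nat) set \<times> nat \<Rightarrow> nat"
  defines "l \<equiv> \<mu> * a * (p + r - 1)"
  defines "G \<equiv> K a p l \<mu>"
  assumes "a > 1" "p \<ge> 1" "r \<ge> 1" "edge_coloring G k c" "2 * k = l * a"
    and paths: "\<And>j. j \<in> {1..k} \<Longrightarrow> \<forall>C\<in>components (color_subgraph G c j). is_path C"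
    and comps: "\<And>j. j \<in> {1..k} \<Longrightarrow> num_components (color_subgraph G c j) \<le> r"
  shows "\<exists>C. partly_split_decomposition a (p + r) l \<mu> k p C \<and>
    (\<forall>j\<in>{1..k}. \<forall>u\<in>verts G. \<forall>v\<in>verts G.
      count (closed_steps (C j)) {u, v} = card {e \<in> edges G. c e = j \<and> fst e = {u, v}})"
proof -
  let ?J = "{1..k}"
  define V where "V = verts G"
  define w where "w = (p, 0::nat)"
  define Z where "Z = {p + 1..<p + r} \<times> {0::nat}"
  have V: "V = {..<p} \<times> {..<a}" "finite V" "w \<notin> V" "card V = p * a"
    by (auto simp: V_def G_def verts_K w_def card_cartesian_product)
  have VZ: "partly_split_verts a (p + r) p = insert w (V \<union> Z)"
    using assms(3-5) by (auto simp: partly_split_verts_def V(1) Z_def w_def)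
  have fstV: "fst v < p" if "v \<in> V" for v using that by (auto simp: V(1))
  have fstZ: "p \<le> fst z" if "z \<in> insert w Z" for z using that by (auto simp: Z_def w_def)
  have "\<exists>E. size E = r \<and> (\<Sum>L\<in>#E. mset L) = mset_set V \<and>
      (\<forall>u\<in>V. \<forall>v\<in>V. count (walk_steps w E) {u, v} = card {e \<in> edges G. c e = j \<and> fst e = {u, v}})"
    if j: "j \<in> ?J" for j
  proof -
    let ?Gj = "color_subgraph G c j"
    have Gj: "verts ?Gj = V" "edges ?Gj = {e \<in> edges G. c e = j}" "ends ?Gj = fst"
      by (simp_all add: color_subgraph_def spanning_subgraph_def color_class_def V_def G_def ends_K)
    have "loopless_multigraph ?Gj"
      using loopless_multigraph_K[of a p l \<mu>]
      unfolding loopless_multigraph_def ends_K Gj unfolding V_def G_def by auto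
    moreover have "finite (verts ?Gj)" "finite (edges ?Gj)"
      unfolding Gj using V(2) by (simp_all add: G_def finite_edges_K)
    ultimately obtain E where "size E = r" "(\<Sum>L\<in>#E. mset L) = mset_set (verts ?Gj)"
      "\<And>w u v. w \<notin> verts ?Gj \<Longrightarrow> u \<in> verts ?Gj \<Longrightarrow> v \<in> verts ?Gj \<Longrightarrow>
        count (walk_steps w E) {u, v} = card {e \<in> edges ?Gj. ends ?Gj e = {u, v}}"
      using ears_of_linear_forest[OF _ _ _ paths[OF j] comps[OF j]] by blast
    then show ?thesis using V(3) by (intro exI[of _ E]) (simp add: Gj)
  qed
  then have "\<forall>j\<in>?J. \<exists>E. size E = r \<and> (\<Sum>L\<in>#E. mset L) = mset_set V \<and>
      (\<forall>u\<in>V. \<forall>v\<in>V. count (walk_steps w E) {u, v} = card {e \<in> edges G. c e = j \<and> fst e = {u, v}})"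
    by blast
  from bchoice[OF this] obtain E where E': "\<forall>j\<in>?J. size (E j) = r \<and>
      (\<Sum>L\<in>#E j. mset L) = mset_set V \<and> (\<forall>u\<in>V. \<forall>v\<in>V.
        count (walk_steps w (E j)) {u, v} = card {e \<in> edges G. c e = j \<and> fst e = {u, v}})" ..
  have E: "size (E j) = r" "(\<Sum>L\<in>#E j. mset L) = mset_set V" if "j \<in> ?J" for j
    using bspec[OF E' that] by simp_all
  have old: "count (walk_steps w (E j)) {u, v} = card {e \<in> edges G. c e = j \<and> fst e = {u, v}}"
    if "j \<in> ?J" "u \<in> V" "v \<in> V" for j u v
    using bspec[OF E' that(1)] that(2,3) by blast
  have old_total: "(\<Sum>j\<in>?J. count (walk_steps w (E j)) {u, v}) = (if fst u = fst v then l else \<mu>)"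
    if "u \<in> V" "v \<in> V" "u \<noteq> v" for u v
  proof -
    have "(\<Sum>j\<in>?J. count (walk_steps w (E j)) {u, v})
        = (\<Sum>j\<in>?J. card {e \<in> edges G. c e = j \<and> fst e = {u, v}})"
      using that by (intro sum.cong refl old)
    also have "\<dots> = card {e \<in> edges G. fst e = {u, v}}"
      using assms(6) unfolding edge_coloring_def
      by (intro sum_card_colors) (simp_all add: G_def finite_edges_K)
    also have "\<dots> = (if fst u = fst v then l else \<mu>)"
      unfolding G_def using that by (intro card_multiplicity_K) (simp_all add: V_def G_def)
    finally show ?thesis .
  qed
  have l_split: "l * a = l * (a - 1) + (\<mu> * a * (p - 1) + r * (\<mu> * a))"
  proof -
    have "p + r - 1 = (p - 1) + r" using assms(4) by simp
    then have "l = \<mu> * a * (p - 1) + r * (\<mu> * a)" by (simp add: l_def algebra_simps)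
    moreover have "l * a = l * (a - 1) + l" using assms(3) by (cases a) auto
    ultimately show ?thesis by simp
  qed
  have bal: "(\<Sum>j\<in>?J. count (walk_steps w (E j)) {w, v}) = r * (\<mu> * a)" if v: "v \<in> V" for v
  proof -
    have "2 * k = (\<Sum>j\<in>?J. count (walk_steps w (E j)) {w, v}
        + (\<Sum>u\<in>V - {v}. count (walk_steps w (E j)) {v, u}))"
      using degree_in_walk_steps[OF E(2) V(2,3) v] by simp
    also have "\<dots> = (\<Sum>j\<in>?J. count (walk_steps w (E j)) {w, v})
        + (\<Sum>u\<in>V - {v}. \<Sum>j\<in>?J. count (walk_steps w (E j)) {v, u})"
      by (simp only: sum.distrib sum.swap[of _ "V - {v}"])
    also have "(\<Sum>u\<in>V - {v}. \<Sum>j\<in>?J. count (walk_steps w (E j)) {v, u})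
        = (\<Sum>u\<in>V - {v}. if fst v = fst u then l else \<mu>)"
      using v by (intro sum.cong refl old_total) auto
    also have "\<dots> = l * (a - 1) + \<mu> * a * (p - 1)"
      using degree_K[of v a p l \<mu>] v by (simp add: V_def G_def)
    finally show ?thesis using l_split assms(7) by linarith
  qed
  have loops: "2 * (\<Sum>j\<in>?J. count (walk_steps w (E j)) {w}) = \<mu> * a * a * r * (r - 1)"
  proof -
    have setE: "set L \<subseteq> V" if "j \<in> ?J" "L \<in># E j" for j L
    proof -
      have "set_mset (\<Sum>L\<in>#E j. mset L) = V" using E(2)[OF that(1)] V(2) by simp
      then show ?thesis using that(2) by (auto simp: set_mset_sum_mset)
    qed
    have "2 * r * k = (\<Sum>j\<in>?J. (\<Sum>v\<in>V. count (walk_steps w (E j)) {w, v})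
        + 2 * count (walk_steps w (E j)) {w})"
      using count_ends_walk_steps[OF setE V(2,3)] E(1) by simp
    also have "\<dots> = (\<Sum>v\<in>V. \<Sum>j\<in>?J. count (walk_steps w (E j)) {w, v})
        + 2 * (\<Sum>j\<in>?J. count (walk_steps w (E j)) {w})"
      by (simp only: sum.distrib sum.swap[of _ V] sum_distrib_left)
    also have "(\<Sum>v\<in>V. \<Sum>j\<in>?J. count (walk_steps w (E j)) {w, v}) = (\<Sum>v\<in>V. r * (\<mu> * a))"
      by (intro sum.cong refl bal)
    also have "\<dots> = p * a * (r * (\<mu> * a))" using V(4) by simp
    finally have "r * (2 * k) = p * a * (r * (\<mu> * a))
        + 2 * (\<Sum>j\<in>?J. count (walk_steps w (E j)) {w})" by simp
    moreover have "r * (2 * k) = p * a * (r * (\<mu> * a)) + \<mu> * a * a * r * (r - 1)"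
    proof -
      have "p + r - 1 = p + (r - 1)" using assms(5) by simp
      then show ?thesis unfolding assms(7) l_def by (simp add: algebra_simps)
    qed
    ultimately show ?thesis by linarith
  qed
  have "\<exists>L. (\<forall>j\<in>?J. mset (L j) = mset_set (V \<union> Z) \<and>
        (\<forall>u\<in>V. \<forall>v\<in>V. count (steps (w # L j @ [w])) {u, v} = count (walk_steps w (E j)) {u, v})) \<and>
      (\<forall>z\<in>insert w Z. \<forall>v\<in>V. (\<Sum>j\<in>?J. count (steps (w # L j @ [w])) {z, v}) = \<mu> * a) \<and>
      (\<forall>z\<in>insert w Z. \<forall>z'\<in>insert w Z. z \<noteq> z' \<longrightarrow>
        (\<Sum>j\<in>?J. count (steps (w # L j @ [w])) {z, z'}) = \<mu> * a * a)"
  proof (rule detachment)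
    show "1 \<le> r" by (rule assms(5))
    show "(\<Sum>j\<in>?J. count (walk_steps w (E j)) {w, v}) = r * (\<mu> * a)" if "v \<in> V" for v
      by (rule bal[OF that])
    show "2 * (\<Sum>j\<in>?J. count (walk_steps w (E j)) {w}) = \<mu> * a * a * r * (r - 1)" by (rule loops)
    show "Z \<inter> insert w V = {}" by (auto simp: Z_def w_def V(1))
    show "card Z = r - 1" by (simp add: Z_def card_cartesian_product)
  qed (use E V(2,3) in \<open>simp_all add: Z_def\<close>)
  then obtain L where
    L12: "\<forall>j\<in>?J. mset (L j) = mset_set (V \<union> Z) \<and>
        (\<forall>u\<in>V. \<forall>v\<in>V. count (steps (w # L j @ [w])) {u, v} = count (walk_steps w (E j)) {u, v})"
    and L3: "\<forall>z\<in>insert w Z. \<forall>v\<in>V. (\<Sum>j\<in>?J. count (steps (w # L j @ [w])) {z, v}) = \<mu> * a"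
    and L4: "\<forall>z\<in>insert w Z. \<forall>z'\<in>insert w Z. z \<noteq> z' \<longrightarrow>
        (\<Sum>j\<in>?J. count (steps (w # L j @ [w])) {z, z'}) = \<mu> * a * a"
    by (elim exE conjE) (rule that)
  define C where "C j = w # L j" for j
  have steps_C: "steps (w # L j @ [w]) = closed_steps (C j)" for j
    by (simp add: C_def closed_steps_Cons)
  have keep: "count (closed_steps (C j)) {u, v} = count (walk_steps w (E j)) {u, v}"
    if "j \<in> ?J" "u \<in> V" "v \<in> V" for j u v
    using bspec[OF bspec[OF conjunct2[OF bspec[OF L12 that(1)]] that(2)] that(3)]
    unfolding steps_C .
  have wtV: "weight a p v = 1" if "v \<in> V" for v using fstV[OF that] by (simp add: weight_def)
  have wtZ: "weight a p z = a" if "z \<in> insert w Z" for z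
    using fstZ[OF that] by (simp add: weight_def)
  have cross: "(\<Sum>j\<in>?J. count (closed_steps (C j)) {z, v}) = \<mu> * weight a p z * weight a p v"
    if "z \<in> insert w Z" "v \<in> V" for z v
    using bspec[OF bspec[OF L3 that(1)] that(2)] unfolding steps_C wtV[OF that(2)] wtZ[OF that(1)]
    by simp
  show ?thesis
    unfolding partly_split_decomposition_def V_def[symmetric]
  proof (intro exI[of _ C] conjI ballI impI)
    fix j assume j: "j \<in> ?J"
    have "w \<notin> V \<union> Z" "finite (V \<union> Z)" using V(2,3) by (auto simp: Z_def w_def)
    then show "mset (C j) = mset_set (partly_split_verts a (p + r) p)"
      using bspec[OF L12 j] unfolding VZ C_def by simp
    fix u v assume "u \<in> V" "v \<in> V"
    then show "count (closed_steps (C j)) {u, v} = card {e \<in> edges G. c e = j \<and> fst e = {u, v}}"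
      using keep[OF j] old[OF j] by simp
  next
    fix u v assume "u \<in> partly_split_verts a (p + r) p" "v \<in> partly_split_verts a (p + r) p"
    then have "u \<in> V \<or> u \<in> insert w Z" "v \<in> V \<or> v \<in> insert w Z" unfolding VZ by auto
    moreover assume "u \<noteq> v"
    ultimately consider "u \<in> V" "v \<in> V" | "u \<in> V" "v \<in> insert w Z" | "u \<in> insert w Z" "v \<in> V"
      | "u \<in> insert w Z" "v \<in> insert w Z" by blast
    then show "(\<Sum>j\<in>?J. count (closed_steps (C j)) {u, v})
        = (if fst u = fst v then l else \<mu> * weight a p u * weight a p v)"
    proof cases
      case 1
      then have "(\<Sum>j\<in>?J. count (closed_steps (C j)) {u, v})
          = (\<Sum>j\<in>?J. count (walk_steps w (E j)) {u, v})"
        by (intro sum.cong refl keep)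
      then show ?thesis using old_total[OF 1 \<open>u \<noteq> v\<close>] wtV[OF 1(1)] wtV[OF 1(2)] by simp
    next
      case 2
      then show ?thesis using cross[OF 2(2,1)] fstV[OF 2(1)] fstZ[OF 2(2)]
        by (simp add: insert_commute mult_ac)
    next
      case 3
      then show ?thesis using cross[OF 3] fstV[OF 3(2)] fstZ[OF 3(1)] by simp
    next
      case 4
      have "fst u \<noteq> fst v" using 4 \<open>u \<noteq> v\<close> by (auto simp: Z_def w_def)
      then show ?thesis using mp[OF bspec[OF bspec[OF L4 4(1)] 4(2)] \<open>u \<noteq> v\<close>]
        unfolding steps_C wtZ[OF 4(1)] wtZ[OF 4(2)] by simp
    qed
  qed
qed

lemma embedding_sufficient:
  fixes a p r k \<mu> :: nat and c :: "(nat \<times> nat) set \<times> nat \<Rightarrow> nat"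
  defines "l \<equiv> \<mu> * a * (p + r - 1)"
  defines "G \<equiv> K a p l \<mu>" and "H \<equiv> K a (p + r) l \<mu>"
  assumes "a > 1" "p \<ge> 1" "r \<ge> 1" "edge_coloring G k c" "2 * k = l * a"
    and paths: "\<And>j. j \<in> {1..k} \<Longrightarrow> \<forall>C\<in>components (color_subgraph G c j). is_path C"
    and comps: "\<And>j. j \<in> {1..k} \<Longrightarrow> num_components (color_subgraph G c j) \<le> r"
  shows "embeds_in_hamiltonian_decomposition G k c H"
proof -
  let ?J = "{1..k}"
  have VG: "verts G = {..<p} \<times> {..<a}" by (simp add: G_def verts_K)
  obtain C where C: "partly_split_decomposition a (p + r) l \<mu> k p C"
    "\<forall>j\<in>?J. \<forall>u\<in>verts G. \<forall>v\<in>verts G.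
      count (closed_steps (C j)) {u, v} = card {e \<in> edges G. c e = j \<and> fst e = {u, v}}"
    using amalgamated_decomposition[of a p r \<mu> k c] assms by blast
  obtain C' where C': "partly_split_decomposition a (p + r) l \<mu> k (p + r) C'"
    "\<forall>j\<in>?J. \<forall>u\<in>verts G. \<forall>v\<in>verts G.
      count (closed_steps (C' j)) {u, v} = count (closed_steps (C j)) {u, v}"
    using split_all_parts[OF _ assms(4,5,8) C(1)] unfolding VG by auto
  have VH: "partly_split_verts a (p + r) (p + r) = verts H"
    by (auto simp: partly_split_verts_def H_def verts_K)
  have mset_C': "mset (C' j) = mset_set (verts H)" if "j \<in> ?J" for j
    using C'(1) that unfolding partly_split_decomposition_def VH by blast
  have C'_props: "distinct (C' j)" "set (C' j) = verts H" "2 \<le> length (C' j)" if "j \<in> ?J" for j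
  proof -
    have fin: "finite (verts H)" by (simp add: H_def verts_K)
    show "distinct (C' j)" "set (C' j) = verts H"
      using mset_eq_mset_setD[OF mset_C'[OF that] fin] by simp_all
    then have "length (C' j) = (p + r) * a"
      by (metis H_def card_verts_K distinct_card)
    moreover have "2 * 2 \<le> (p + r) * a" using assms(4-6) by (intro mult_le_mono) auto
    ultimately show "2 \<le> length (C' j)" by simp
  qed
  have "\<exists>c'. edge_coloring (K a (p + r) l \<mu>) k c' \<and> (\<forall>e\<in>edges (K a p l \<mu>). c' e = c e) \<and>
    (\<forall>j\<in>?J. image_mset fst (mset_set (color_class (K a (p + r) l \<mu>) c' j)) = closed_steps (C' j))"
  proof (rule extend_coloring)
    show "edge_coloring (K a p l \<mu>) k c" using assms(7) by (simp add: G_def)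
    show "count (closed_steps (C' j)) {u, v}
        = card {e \<in> edges (K a p l \<mu>). c e = j \<and> fst e = {u, v}}"
      if "j \<in> ?J" "u \<in> verts (K a p l \<mu>)" "v \<in> verts (K a p l \<mu>)" for j u v
      using C(2) C'(2) that unfolding G_def by simp
    show "(\<Sum>j\<in>?J. count (closed_steps (C' j)) {u, v}) = (if fst u = fst v then l else \<mu>)"
      if "u \<in> verts (K a (p + r) l \<mu>)" "v \<in> verts (K a (p + r) l \<mu>)" "u \<noteq> v" for u v
    proof -
      have "weight a (p + r) u = 1" "weight a (p + r) v = 1"
        using that by (auto simp: weight_def verts_K)
      then show ?thesis
        using C'(1) that unfolding partly_split_decomposition_def VH H_def by simp
    qed
    show "e \<subseteq> verts (K a (p + r) l \<mu>) \<and> card e = 2"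
      if "j \<in> ?J" "e \<in># closed_steps (C' j)" for j e
      using closed_steps_subset[OF that(2)] C'_props[OF that(1)]
        closed_steps_distinct_card[OF _ _ that(2)] by (simp add: H_def)
  qed simp
  then obtain c' where c': "edge_coloring H k c'" "\<forall>e\<in>edges G. c' e = c e"
    "\<forall>j\<in>?J. image_mset fst (mset_set (color_class H c' j)) = closed_steps (C' j)"
    unfolding G_def H_def by blast
  have "hamiltonian_cycle H (color_class H c' j)" if "j \<in> ?J" for j
  proof -
    have "finite (color_class H c' j)" "color_class H c' j \<subseteq> edges H" "ends H = fst"
      by (auto simp: color_class_def H_def finite_edges_K ends_K)
    then show ?thesis
      using hamiltonian_cycle_iff[of "color_class H c' j" H] c'(3) C'_props[OF that] that by auto
  qed
  then show ?thesis using c'(1,2) unfolding embeds_in_hamiltonian_decomposition_def by blast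
qed

theorem theorem4:
  fixes a p r k \<mu> :: nat
    and c :: "(nat \<times> nat) set \<times> nat \<Rightarrow> nat"
  defines "G \<equiv> K a p (\<mu> * a * (p + r - 1)) \<mu>"
    and "H \<equiv> K a (p + r) (\<mu> * a * (p + r - 1)) \<mu>"
  assumes "a > 1" and "p \<ge> 1" and "r \<ge> 1" and "k \<ge> 1" and "\<mu> \<ge> 1"
    and "edge_coloring G k c"
  shows "embeds_in_hamiltonian_decomposition G k c H \<longleftrightarrow>
    real k = real (\<mu> * a\<^sup>2 * (p + r - 1)) / 2 \<and>
    (\<forall>j\<in>{1..k}. \<forall>C\<in>components (color_subgraph G c j). is_path C) \<and>
    (\<forall>j\<in>{1..k}.
       (\<forall>i<p. card (pure_edges a (color_subgraph G c j) i) = a - 1) \<and>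
       card (mixed_edges (color_subgraph G c j)) \<le> p - 1) \<and>
    (\<forall>j\<in>{1..k}. num_components (color_subgraph G c j) \<le> r)"
proof -
  have "\<mu> * a * (p + r - 1) * a = \<mu> * a\<^sup>2 * (p + r - 1)"
    by (simp add: power2_eq_square mult_ac)
  then have k: "real k = real (\<mu> * a\<^sup>2 * (p + r - 1)) / 2
      \<longleftrightarrow> 2 * k = \<mu> * a * (p + r - 1) * a"
    by linarith
  show ?thesis
  proof
    assume "embeds_in_hamiltonian_decomposition G k c H"
    from embedding_necessary[OF assms(3-5) this[unfolded G_def H_def]]
    show "real k = real (\<mu> * a\<^sup>2 * (p + r - 1)) / 2 \<and>
      (\<forall>j\<in>{1..k}. \<forall>C\<in>components (color_subgraph G c j). is_path C) \<and>
      (\<forall>j\<in>{1..k}.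
         (\<forall>i<p. card (pure_edges a (color_subgraph G c j) i) = a - 1) \<and>
         card (mixed_edges (color_subgraph G c j)) \<le> p - 1) \<and>
      (\<forall>j\<in>{1..k}. num_components (color_subgraph G c j) \<le> r)"
      unfolding k G_def by blast
  next
    assume "real k = real (\<mu> * a\<^sup>2 * (p + r - 1)) / 2 \<and>
      (\<forall>j\<in>{1..k}. \<forall>C\<in>components (color_subgraph G c j). is_path C) \<and>
      (\<forall>j\<in>{1..k}.
         (\<forall>i<p. card (pure_edges a (color_subgraph G c j) i) = a - 1) \<and>
         card (mixed_edges (color_subgraph G c j)) \<le> p - 1) \<and>
      (\<forall>j\<in>{1..k}. num_components (color_subgraph G c j) \<le> r)"
    then show "embeds_in_hamiltonian_decomposition G k c H"
      using embedding_sufficient[OF assms(3-5) assms(8)[unfolded G_def]]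
      unfolding k G_def H_def by blast
  qed
qed

end
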